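(* If $T$ is a locally bounded operator on a sequentially complete locally convex space $X$, then $$r_{lb}(T)=|\sigma(T)|=|\sigma_{lb}(T)|=|\sigma(Q,T)|.$$
   Context: All locally convex spaces are Hausdorff over $\mathbb{C}$ and all operators are linear. An operator $T:X\to X$ is locally bounded if it maps some zero neighborhood into a bounded set. A sequence $(S_n)$ of operators converges to zero uniformly on a zero neighborhood $U$ if for each zero neighborhood $V$ there is $n_0$ with $S_n(U)\subset V$ for all $n\ge n_0$. Define $r_{lb}(T)=\inf\{\nu>0: T^n/\nu^n\to0 \text{ uniformly on some zero neighborhood}\}$. For a set $\sigma\subset\mathbb{C}$, $|\sigma|=\sup\{|\lambda|:\lambda\in\sigma\}\in[0,\infty]$. The spectrum $\sigma(T)$ is the complement of $\rho(T)$, the set of $\lambda\in\mathbb{C}$ such that $\lambda I-T$ has a continuous linear inverse on $X$. The set $\sigma_{lb}(T)$ is the complement in $\mathbb{C}$ of $\rho_{lb}(T)$, the set of $\lambda$ such that $\lambda I-T$ is invertible and $(\lambda I-T)^{-1}=\alpha I+S$ for some scalar $\alpha$ and some locally bounded operator $S$ on $X$. A calibration on $X$ is a family $\mathcal{P}$ of seminorms generating the topology of $X$ (the sets $\{x: p(x)<\varepsilon\}$, $p\in\mathcal{P}$, $\varepsilon>0$, form a neighborhood sub-base at $0$). $Q_{\mathcal{P}}(X)$ is the algebra of operators $T$ on $X$ such that for every $p\in\mathcal{P}$ there is $c_p>0$ with $p(Tx)\le c_p\,p(x)$ for all $x\in X$. For $T\in Q_{\mathcal{P}}(X)$, $\rho(Q_{\mathcal{P}},T)$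 is the set of $\lambda\in\mathbb{C}$ such that $\lambda I-T$ is invertible with inverse in $Q_{\mathcal{P}}(X)$, and $\sigma(Q_{\mathcal{P}},T)=\mathbb{C}\setminus\rho(Q_{\mathcal{P}},T)$. Finally $\sigma(Q,T)=\bigcap\{\sigma(Q_{\mathcal{P}},T): \mathcal{P}\text{ a calibration on }X\text{ with }T\in Q_{\mathcal{P}}(X)\}$ (every locally bounded operator belongs to $Q_{\mathcal{P}}(X)$ for some calibration $\mathcal{P}$). *)

theory Defs
  imports "HOL-Analysis.Analysis"
begin

(* Complex vector spaces. The real_vector structure is the restriction of scalars. *)
class complex_vector = real_vector +
  fixes scaleC :: "complex \<Rightarrow> 'a \<Rightarrow> 'a"  (infixr "*\<^sub>C" 75)
  assumes scaleC_add_right: "a *\<^sub>C (x + y) = a *\<^sub>C x + a *\<^sub>C y"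
    and scaleC_add_left: "(a + b) *\<^sub>C x = a *\<^sub>C x + b *\<^sub>C x"
    and scaleC_scaleC: "a *\<^sub>C (b *\<^sub>C x) = (a * b) *\<^sub>C x"
    and scaleC_one: "1 *\<^sub>C x = x"
    and scaleR_scaleC: "r *\<^sub>R x = complex_of_real r *\<^sub>C x"

(* The first assumption is joint continuity of scalar multiplication. Convexity is unfolded in the
   second one, as the constant convex cannot be used on the type parameter of a class; see the
   two lemmas below. *)
class locally_convex_space = complex_vector + topological_ab_group_add + t2_space +
  assumes tendsto_scaleC_Pair: "LIM p (nhds c \<times>\<^sub>F nhds x). fst p *\<^sub>C snd p :> nhds (c *\<^sub>C x)"
    and locally_convex_unfolded: "open U \<Longrightarrow> 0 \<in> U \<Longrightarrow>
      \<exists>V W. (\<forall>x\<in>V. \<forall>y\<in>V. \<forall>u\<ge>0. \<forall>v\<ge>0. u + v = 1 \<longrightarrow> u *\<^sub>R x + v *\<^sub>R y \<in> V) \<and>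
        open W \<and> 0 \<in> W \<and> W \<subseteq> V \<and> V \<subseteq> U"

lemma continuous_scaleC:
  "continuous_on UNIV (\<lambda>(c, x). c *\<^sub>C (x :: 'a::locally_convex_space))"
  by (auto simp: continuous_on_def case_prod_unfold
      intro: filterlim_mono[OF tendsto_scaleC_Pair[folded nhds_prod] order_refl]
        simp: at_within_def)

lemma locally_convex:
  fixes U :: "'a::locally_convex_space set"
  assumes "open U" "0 \<in> U"
  shows "\<exists>V. convex V \<and> 0 \<in> interior V \<and> V \<subseteq> U"
  using locally_convex_unfolded[OF assms] unfolding convex_def by (metis interiorI)

definition zero_neighborhood :: "'a::locally_convex_space set \<Rightarrow> bool" where
  "zero_neighborhood U \<longleftrightarrow> 0 \<in> interior U"

(* Boundedness in the von Neumann sense: absorbed by every zero neighborhood. *)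
definition vN_bounded :: "'a::locally_convex_space set \<Rightarrow> bool" where
  "vN_bounded B \<longleftrightarrow>
     (\<forall>V. zero_neighborhood V \<longrightarrow> (\<exists>s>0. \<forall>c. norm c \<ge> s \<longrightarrow> B \<subseteq> (\<lambda>x. c *\<^sub>C x) ` V))"

definition lcs_Cauchy :: "(nat \<Rightarrow> 'a::locally_convex_space) \<Rightarrow> bool" where
  "lcs_Cauchy s \<longleftrightarrow>
     (\<forall>V. zero_neighborhood V \<longrightarrow> (\<exists>N. \<forall>m\<ge>N. \<forall>n\<ge>N. s m - s n \<in> V))"

definition seq_complete :: "'a::locally_convex_space set \<Rightarrow> bool" where
  "seq_complete S \<longleftrightarrow>
     (\<forall>s. (\<forall>n. s n \<in> S) \<and> lcs_Cauchy s \<longrightarrow> (\<exists>l\<in>S. s \<longlonglongrightarrow> l))"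

abbreviation clinear :: "('a::complex_vector \<Rightarrow> 'a) \<Rightarrow> bool" where
  "clinear \<equiv> Vector_Spaces.linear scaleC scaleC"

definition locally_bounded_op :: "('a::locally_convex_space \<Rightarrow> 'a) \<Rightarrow> bool" where
  "locally_bounded_op T \<longleftrightarrow> clinear T \<and> (\<exists>U. zero_neighborhood U \<and> vN_bounded (T ` U))"

definition uniformly_to_zero_on ::
    "'a::locally_convex_space set \<Rightarrow> (nat \<Rightarrow> 'a \<Rightarrow> 'a) \<Rightarrow> bool" where
  "uniformly_to_zero_on U S \<longleftrightarrow>
     (\<forall>V. zero_neighborhood V \<longrightarrow> (\<exists>n0. \<forall>n\<ge>n0. S n ` U \<subseteq> V))"

definition r_lb :: "('a::locally_convex_space \<Rightarrow> 'a) \<Rightarrow> ennreal" where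
  "r_lb T = Inf {ennreal \<nu> | \<nu>. \<nu> > 0 \<and>
     (\<exists>U. zero_neighborhood U \<and> uniformly_to_zero_on U (\<lambda>n x. (T ^^ n) x /\<^sub>R \<nu> ^ n))}"

(* The supremum is taken in ennreal, so that the empty set has radius 0. *)
definition set_radius :: "complex set \<Rightarrow> ennreal" where
  "set_radius \<sigma> = (SUP z\<in>\<sigma>. ennreal (norm z))"

(* The scalars z such that z I - T has a two-sided inverse belonging to A. *)
definition resolvent_in ::
    "('a::locally_convex_space \<Rightarrow> 'a) set \<Rightarrow> ('a \<Rightarrow> 'a) \<Rightarrow> complex set" where
  "resolvent_in A T = {z. \<exists>R\<in>A. (\<forall>x. R (z *\<^sub>C x - T x) = x) \<and> (\<forall>x. z *\<^sub>C R x - T (R x) = x)}"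

definition spectrum :: "('a::locally_convex_space \<Rightarrow> 'a) \<Rightarrow> complex set" where
  "spectrum T = - resolvent_in {R. clinear R \<and> continuous_on UNIV R} T"

definition spectrum_lb :: "('a::locally_convex_space \<Rightarrow> 'a) \<Rightarrow> complex set" where
  "spectrum_lb T = - resolvent_in {\<lambda>x. \<alpha> *\<^sub>C x + S x | \<alpha> S. locally_bounded_op S} T"

definition is_seminorm :: "('a::complex_vector \<Rightarrow> real) \<Rightarrow> bool" where
  "is_seminorm p \<longleftrightarrow>
     (\<forall>x. 0 \<le> p x) \<and> (\<forall>x y. p (x + y) \<le> p x + p y) \<and> (\<forall>c x. p (c *\<^sub>C x) = norm c * p x)"

(* The finite intersections of the sets {x. p x < \<epsilon>}, p in P and \<epsilon> > 0, form a base of the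
   zero neighborhoods. *)
definition calibration :: "('a::locally_convex_space \<Rightarrow> real) set \<Rightarrow> bool" where
  "calibration P \<longleftrightarrow> (\<forall>p\<in>P. is_seminorm p) \<and>
     (\<forall>U. zero_neighborhood U \<longleftrightarrow>
        (\<exists>F. finite F \<and> F \<subseteq> P \<times> {0<..} \<and> (\<Inter>(p, \<epsilon>)\<in>F. {x. p x < \<epsilon>}) \<subseteq> U))"

definition Q_algebra :: "('a::locally_convex_space \<Rightarrow> real) set \<Rightarrow> ('a \<Rightarrow> 'a) set" where
  "Q_algebra P = {T. clinear T \<and> (\<forall>p\<in>P. \<exists>c>0. \<forall>x. p (T x) \<le> c * p x)}"

definition spectrum_QP ::
    "('a::locally_convex_space \<Rightarrow> real) set \<Rightarrow> ('a \<Rightarrow> 'a) \<Rightarrow> complex set" where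
  "spectrum_QP P T = - resolvent_in (Q_algebra P) T"

definition spectrum_Q :: "('a::locally_convex_space \<Rightarrow> 'a) \<Rightarrow> complex set" where
  "spectrum_Q T = \<Inter>{spectrum_QP P T | P. calibration P \<and> T \<in> Q_algebra P}"

end

theory Submission imports Defs begin

text \<open>If \<open>T\<^sup>n / \<nu>\<^sup>n\<close> tends to zero uniformly on a zero neighborhood, then for \<open>\<bar>z\<bar> > \<nu>\<close> the Neumann series
  converges by sequential completeness to \<open>I / z + S\<close>. The operators \<open>T\<close> and \<open>S\<close> are bounded with respect
  to one continuous seminorm \<open>h\<close>, so all continuous seminorms above \<open>h\<close> form a calibration whose
  algebra contains \<open>T\<close> and the resolvent. Hence both larger spectra lie in the disc of radius \<open>r_lb T\<close>.

  Conversely, if the resolvent exists outside a disc, put \<open>F w = (I - w T)\<^sup>-\<^sup>1\<close>. Since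
  \<open>F w = I + w F w T\<close>, every \<open>F w\<close> is bounded for a single seminorm \<open>g\<close> whose unit ball \<open>T\<close> maps
  to a bounded set. The mean of \<open>F (s \<omega>\<^sup>j)\<close> over the \<open>N\<close>-th roots of unity inverts \<open>I - s\<^sup>N T\<^sup>N\<close>,
  and these means are Lipschitz in \<open>s\<close> uniformly in \<open>N\<close>. This propagates the decay of \<open>s\<^sup>N T\<^sup>N\<close>
  from \<open>s = 0\<close> to the whole interval in small steps, with no holomorphy or duality involved.\<close>

section \<open>Complex-linear maps\<close>

interpretation cvec: vector_space "scaleC :: complex \<Rightarrow> 'a \<Rightarrow> 'a::complex_vector"
  by unfold_locales (simp_all add: scaleC_add_right scaleC_add_left scaleC_scaleC scaleC_one)

lemma clinear_iff:
  "clinear (T :: 'a::complex_vector \<Rightarrow> 'a) \<longleftrightarrow>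
    (\<forall>x y. T (x + y) = T x + T y) \<and> (\<forall>c x. T (c *\<^sub>C x) = c *\<^sub>C T x)"
  using cvec.vector_space_axioms by (auto simp: Vector_Spaces.linear_iff)

context
  fixes T :: "'a::complex_vector \<Rightarrow> 'a"
  assumes lin: "clinear T"
begin

lemma clinear_add: "T (x + y) = T x + T y"
  and clinear_scale: "T (c *\<^sub>C x) = c *\<^sub>C T x"
  using lin by (simp_all add: clinear_iff)

lemma clinear_zero: "T 0 = 0"
  using clinear_scale[of 0 0] by simp

lemma clinear_diff: "T (x - y) = T x - T y"
  using clinear_add[of "x - y" y] by simp

lemma clinear_sum: "T (\<Sum>i\<in>I. f i) = (\<Sum>i\<in>I. T (f i))"
  by (induction I rule: infinite_finite_induct) (simp_all add: clinear_zero clinear_add)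

lemma clinear_funpow: "clinear (T ^^ n)"
  by (induction n) (simp_all add: clinear_iff clinear_add clinear_scale)

end

section \<open>Continuous seminorms\<close>

context
  fixes p :: "'a::complex_vector \<Rightarrow> real"
  assumes p: "is_seminorm p"
begin

lemma seminorm_nonneg: "0 \<le> p x"
  and seminorm_triangle: "p (x + y) \<le> p x + p y"
  and seminorm_scale: "p (c *\<^sub>C x) = norm c * p x"
  using p by (auto simp: is_seminorm_def)

lemma seminorm_zero: "p 0 = 0"
  using seminorm_scale[of 0 0] by simp

lemma seminorm_minus: "p (- x) = p x"
  using seminorm_scale[of "-1" x] by simp

lemma seminorm_triangle_diff: "p (x - y) \<le> p x + p y"
  using seminorm_triangle[of x "- y"] by (simp add: seminorm_minus)

lemma seminorm_minus_commute: "p (x - y) = p (y - x)"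
  using seminorm_minus[of "x - y"] by simp

lemma seminorm_sum: "p (\<Sum>i\<in>I. f i) \<le> (\<Sum>i\<in>I. p (f i))"
  by (induction I rule: infinite_finite_induct)
    (auto simp: seminorm_zero intro: order_trans[OF seminorm_triangle])

lemma seminorm_comp: "clinear T \<Longrightarrow> is_seminorm (\<lambda>x. p (T x))"
  by (auto simp: is_seminorm_def clinear_iff seminorm_nonneg seminorm_triangle seminorm_scale)

end

text \<open>For every t > \<open>p x\<close> the vector x / t lies in the unit ball of
  \<open>p\<close>, so homogeneity gives \<open>q x\<close> \<le> C t; then t decreases to
  \<open>p x\<close>. Dividing by \<open>p x\<close> itself is impossible when it vanishes.\<close>

lemma bound_on_unit_imp_le_seminorm:
  assumes p: "is_seminorm p" and q: "is_seminorm q"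
    and le: "\<And>x. p x < 1 \<Longrightarrow> q x \<le> C"
  shows "q x \<le> C * p x"
proof -
  have *: "q x \<le> C * t" if "t > p x" for t
  proof -
    have t: "t > 0" using that seminorm_nonneg[OF p, of x] by linarith
    have "q (complex_of_real (1 / t) *\<^sub>C x) \<le> C"
      using that t by (intro le) (simp add: seminorm_scale[OF p] field_simps norm_divide)
    thus ?thesis using t by (simp add: seminorm_scale[OF q] field_simps norm_divide)
  qed
  have C: "C \<ge> 0" using le[of 0] by (simp add: seminorm_zero[OF p] seminorm_zero[OF q])
  show ?thesis
  proof (rule field_le_epsilon)
    fix e :: real assume e: "e > 0"
    \<comment> \<open>The denominator is \<open>C + 1\<close> because \<open>C\<close> may be
      zero.\<close>
    have "q x \<le> C * (p x + e / (C + 1))" using C e by (intro *) simp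
    also have "\<dots> \<le> C * p x + e" using C e by (simp add: field_simps)
    finally show "q x \<le> C * p x + e" .
  qed
qed

section \<open>Zero neighborhoods and the continuity of seminorms\<close>

lemma zero_neighborhood_mono: "zero_neighborhood U \<Longrightarrow> U \<subseteq> V \<Longrightarrow> zero_neighborhood V"
  unfolding zero_neighborhood_def using interior_mono by blast

lemma zero_neighborhood_Int: "zero_neighborhood U \<Longrightarrow> zero_neighborhood V \<Longrightarrow> zero_neighborhood (U \<inter> V)"
  unfolding zero_neighborhood_def by simp

lemma zero_neighborhood_INT:
  "finite F \<Longrightarrow> (\<And>i. i \<in> F \<Longrightarrow> zero_neighborhood (U i)) \<Longrightarrow> zero_neighborhood (\<Inter>i\<in>F. U i)"
  by (induction F rule: finite_induct) (auto intro!: zero_neighborhood_Int simp: zero_neighborhood_def)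

lemma continuous_on_scaleC_left: "continuous_on UNIV (\<lambda>x::'a::locally_convex_space. c *\<^sub>C x)"
  using continuous_on_compose2[OF continuous_scaleC, of UNIV "\<lambda>x. (c, x)"]
  by (simp add: continuous_on_Pair)

lemma zero_neighborhood_scaleC:
  fixes V :: "'a::locally_convex_space set"
  assumes "zero_neighborhood V"
  shows "zero_neighborhood {x. c *\<^sub>C x \<in> V}"
proof -
  have "open ((\<lambda>x::'a. c *\<^sub>C x) -` interior V)"
    by (intro open_vimage continuous_on_scaleC_left) auto
  moreover have "(\<lambda>x. c *\<^sub>C x) -` interior V \<subseteq> {x. c *\<^sub>C x \<in> V}"
    using interior_subset by auto
  ultimately show ?thesis
    using assms unfolding zero_neighborhood_def by (intro interiorI) auto
qed

text \<open>Continuity is required at zero only; the reverse triangle inequality spreads it to every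
  point.\<close>

definition continuous_seminorm :: "('a::locally_convex_space \<Rightarrow> real) \<Rightarrow> bool" where
  "continuous_seminorm p \<longleftrightarrow> is_seminorm p \<and> (\<forall>\<epsilon>>0. zero_neighborhood {x. p x < \<epsilon>})"

lemma continuous_seminorm_is_seminorm: "continuous_seminorm p \<Longrightarrow> is_seminorm p"
  by (simp add: continuous_seminorm_def)

text \<open>One sublevel set suffices, since dilating it puts a zero neighborhood inside every other
  one. No sign of \<open>C\<close> is assumed, hence the absolute value in \<open>t\<close>.\<close>

lemma continuous_seminormI:
  fixes p :: "'a::locally_convex_space \<Rightarrow> real"
  assumes p: "is_seminorm p" and nb: "zero_neighborhood {x. p x \<le> C}"
  shows "continuous_seminorm p"
  unfolding continuous_seminorm_def
proof (intro conjI allI impI)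
  fix \<epsilon> :: real assume e: "\<epsilon> > 0"
  define t where "t = (\<bar>C\<bar> + 1) / \<epsilon>"
  have "t * \<epsilon> = \<bar>C\<bar> + 1" using e by (simp add: t_def)
  hence t: "t > 0" "t * \<epsilon> > C" using e by (auto simp: t_def)
  have "{x. complex_of_real t *\<^sub>C x \<in> {x. p x \<le> C}} \<subseteq> {x. p x < \<epsilon>}"
  proof safe
    fix x assume "p (complex_of_real t *\<^sub>C x) \<le> C"
    hence "t * p x \<le> C" using t by (simp add: seminorm_scale[OF p])
    hence "t * p x < t * \<epsilon>" using t(2) by linarith
    thus "p x < \<epsilon>" using t(1) mult_less_cancel_left_pos by blast
  qed
  with zero_neighborhood_scaleC[OF nb] show "zero_neighborhood {x. p x < \<epsilon>}"
    by (rule zero_neighborhood_mono)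
qed (rule p)

lemma continuous_seminorm_add:
  assumes "continuous_seminorm p" "continuous_seminorm q"
  shows "continuous_seminorm (\<lambda>x. p x + q x)"
proof (rule continuous_seminormI)
  show "is_seminorm (\<lambda>x. p x + q x)"
    using assms by (auto simp: continuous_seminorm_def is_seminorm_def algebra_simps)
      (smt (verit))
  show "zero_neighborhood {x. p x + q x \<le> 2}"
    by (rule zero_neighborhood_mono[of "{x. p x < 1} \<inter> {x. q x < 1}"])
      (use assms in \<open>auto simp: continuous_seminorm_def intro!: zero_neighborhood_Int\<close>)
qed

lemma continuous_seminorm_cmult:
  assumes p: "continuous_seminorm p" and C: "C \<ge> 0"
  shows "continuous_seminorm (\<lambda>x. C * p x)"
proof (rule continuous_seminormI)
  show "is_seminorm (\<lambda>x. C * p x)"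
    using p C by (auto simp: continuous_seminorm_def is_seminorm_def simp flip: distrib_left
        intro: mult_left_mono)
  show "zero_neighborhood {x. C * p x \<le> C}"
    by (rule zero_neighborhood_mono[of "{x. p x < 1}"])
      (use p C in \<open>auto simp: continuous_seminorm_def mult_left_le\<close>)
qed

lemma continuous_seminorm_comp:
  assumes p: "continuous_seminorm p" and T: "clinear T" "continuous_on UNIV T"
  shows "continuous_seminorm (\<lambda>x. p (T x))"
proof (rule continuous_seminormI)
  show "is_seminorm (\<lambda>x. p (T x))"
    using p T by (auto simp: continuous_seminorm_def intro: seminorm_comp)
  have "zero_neighborhood {x. p x < 1}" using p by (simp add: continuous_seminorm_def)
  hence "0 \<in> T -` interior {x. p x < 1}"
    by (simp add: zero_neighborhood_def clinear_zero[OF T(1)])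
  moreover have "open (T -` interior {x. p x < 1})" using T by (intro open_vimage) auto
  moreover have "T -` interior {x. p x < 1} \<subseteq> {x. p (T x) \<le> 1}"
    using interior_subset[of "{x. p x < 1}"] by (auto intro: less_imp_le)
  ultimately show "zero_neighborhood {x. p (T x) \<le> 1}"
    unfolding zero_neighborhood_def by (auto intro: interiorI)
qed

text \<open>\<open>V\<close> is the balanced core of a convex neighborhood \<open>W\<close>. It
  inherits convexity from \<open>W\<close>, and joint continuity of scalar multiplication at (0, 0)
  keeps it a neighborhood.\<close>

lemma balanced_convex_neighborhood:
  fixes U :: "'a::locally_convex_space set"
  assumes "zero_neighborhood U"
  obtains V where "convex V" "zero_neighborhood V" "V \<subseteq> U"
    "\<And>c x. norm c \<le> 1 \<Longrightarrow> x \<in> V \<Longrightarrow> c *\<^sub>C x \<in> V"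
proof -
  obtain W where W: "convex W" "0 \<in> interior W" "W \<subseteq> interior U"
    using locally_convex[of "interior U"] assms unfolding zero_neighborhood_def by auto
  define V where "V = {x. \<forall>c. norm c \<le> 1 \<longrightarrow> c *\<^sub>C x \<in> W}"
  have "convex V"
    unfolding V_def convex_def
  proof safe
    fix x y :: 'a and u v :: real and c :: complex
    assume *: "\<forall>c. norm c \<le> 1 \<longrightarrow> c *\<^sub>C x \<in> W" "\<forall>c. norm c \<le> 1 \<longrightarrow> c *\<^sub>C y \<in> W"
      "0 \<le> u" "0 \<le> v" "u + v = 1" "norm c \<le> 1"
    have "u *\<^sub>R (c *\<^sub>C x) + v *\<^sub>R (c *\<^sub>C y) \<in> W"
      using * by (intro convexD[OF W(1)]) auto
    thus "c *\<^sub>C (u *\<^sub>R x + v *\<^sub>R y) \<in> W"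
      by (simp add: scaleC_add_right scaleR_scaleC scaleC_scaleC mult.commute)
  qed
  moreover have "V \<subseteq> U"
  proof
    fix x assume "x \<in> V"
    hence "1 *\<^sub>C x \<in> W" unfolding V_def using norm_one by (metis (mono_tags) mem_Collect_eq order_refl)
    thus "x \<in> U" using W(3) interior_subset[of U] by auto
  qed
  moreover have "c *\<^sub>C x \<in> V" if "norm c \<le> 1" "x \<in> V" for c x
  proof -
    have "norm (d * c) \<le> 1" if "norm d \<le> 1" for d
      using that \<open>norm c \<le> 1\<close> by (simp add: norm_mult mult_le_one)
    thus ?thesis using \<open>x \<in> V\<close> unfolding V_def by (auto simp: scaleC_scaleC)
  qed
  moreover have "zero_neighborhood V"
  proof -
    have "open ((\<lambda>(c, x::'a). c *\<^sub>C x) -` interior W)"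
      by (intro open_vimage continuous_scaleC) auto
    moreover have "(0, 0) \<in> (\<lambda>(c, x::'a). c *\<^sub>C x) -` interior W" using W(2) by simp
    ultimately obtain A B where AB: "open A" "open B" "0 \<in> A" "0 \<in> B"
      "A \<times> B \<subseteq> (\<lambda>(c, x::'a). c *\<^sub>C x) -` interior W"
      by (rule open_prod_elim) auto
    obtain d where d: "d > 0" "cball 0 d \<subseteq> A" using AB open_contains_cball by blast
    have "zero_neighborhood B" using AB by (auto simp: zero_neighborhood_def interior_open)
    \<comment> \<open>The set on the left is the dilate d B. For x in it, c x = (c d) (x / d) is a
      product of a scalar in \<open>A\<close> and a vector in \<open>B\<close>.\<close>
    moreover have "{x. complex_of_real (1 / d) *\<^sub>C x \<in> B} \<subseteq> V"
      unfolding V_def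
    proof safe
      fix x :: 'a and c :: complex
      assume x: "complex_of_real (1 / d) *\<^sub>C x \<in> B" and c: "norm c \<le> 1"
      have "c * d \<in> A" using c d by (intro subsetD[OF d(2)]) (simp add: norm_mult)
      hence "(c * d) *\<^sub>C (complex_of_real (1 / d) *\<^sub>C x) \<in> interior W" using AB(5) x by auto
      thus "c *\<^sub>C x \<in> W" using d interior_subset[of W] by (auto simp: scaleC_scaleC)
    qed
    ultimately show ?thesis using zero_neighborhood_scaleC zero_neighborhood_mono by blast
  qed
  ultimately show ?thesis using that by blast
qed

text \<open>The seminorm is the Minkowski functional of a balanced convex neighborhood
  \<open>V\<close>: balancedness yields homogeneity and convexity the triangle inequality.\<close>

lemma continuous_seminorm_below_neighborhood:
  fixes U :: "'a::locally_convex_space set"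
  assumes "zero_neighborhood U"
  obtains p where "continuous_seminorm p" "{x. p x < 1} \<subseteq> U"
proof -
  obtain V where V: "convex V" "zero_neighborhood V" "V \<subseteq> U"
    and bal: "\<And>c x. norm c \<le> 1 \<Longrightarrow> x \<in> V \<Longrightarrow> c *\<^sub>C x \<in> V"
    using balanced_convex_neighborhood[OF assms] by metis
  \<comment> \<open>\<open>A x\<close> consists of the t > 0 with x in t V. It is upward closed
    because \<open>V\<close> is balanced, and nonempty because c x tends to 0 as c does.\<close>
  define A where "A x = {t. t > 0 \<and> inverse (complex_of_real t) *\<^sub>C x \<in> V}" for x
  define p where "p x = Inf (A x)" for x
  have bdd: "bdd_below (A x)" for x unfolding A_def by (rule bdd_belowI[of _ 0]) auto
  have up: "t \<in> A x" if "s \<in> A x" "s \<le> t" for s t x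
  proof -
    have st: "s > 0" "t > 0" and "inverse (complex_of_real s) *\<^sub>C x \<in> V"
      using that by (auto simp: A_def)
    hence "complex_of_real (s / t) *\<^sub>C (inverse (complex_of_real s) *\<^sub>C x) \<in> V"
      using that by (intro bal[of "complex_of_real (s / t)"]) (auto simp: norm_divide)
    moreover have "complex_of_real (s / t) * inverse (complex_of_real s) = inverse (complex_of_real t)"
      using st by (simp add: field_simps)
    ultimately show ?thesis using st by (simp add: A_def scaleC_scaleC)
  qed
  have ne: "A x \<noteq> {}" for x
  proof -
    have "open ((\<lambda>c. c *\<^sub>C x) -` interior V)"
      using continuous_on_compose2[OF continuous_scaleC, of UNIV "\<lambda>c. (c, x)"]
      by (intro open_vimage) (auto simp: continuous_on_Pair)
    moreover have "0 \<in> (\<lambda>c. c *\<^sub>C x) -` interior V"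
      using V(2) by (simp add: zero_neighborhood_def)
    ultimately obtain e where e: "e > 0" "cball 0 e \<subseteq> (\<lambda>c. c *\<^sub>C x) -` interior V"
      using open_contains_cball by blast
    have "complex_of_real e \<in> cball 0 e" using e by simp
    hence "complex_of_real e *\<^sub>C x \<in> interior V" using e(2) by blast
    hence "complex_of_real e *\<^sub>C x \<in> V" by (rule subsetD[OF interior_subset])
    hence "inverse e \<in> A x" using e by (simp add: A_def)
    thus ?thesis by auto
  qed
  have less: "t \<in> A x" if "p x < t" for x t
    using that cInf_lessD[OF ne, of x t] up by (auto simp: p_def intro: less_imp_le)
  have le: "p x \<le> t" if "t \<in> A x" for x t
    using that bdd unfolding p_def by (rule cInf_lower)
  have nonneg: "p x \<ge> 0" for x
    unfolding p_def using ne by (intro cInf_greatest) (auto simp: A_def)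
  \<comment> \<open>Only one inequality is shown here; the other one follows later by applying this
    one to \<open>inverse c\<close> and \<open>c *\<^sub>C x\<close>. The phase c / |c| is harmless
    since \<open>V\<close> is balanced.\<close>
  have scale_le: "p (c *\<^sub>C x) \<le> norm c * p x" if c: "c \<noteq> 0" for c x
  proof (rule dense_ge)
    fix t assume "norm c * p x < t"
    hence "t / norm c \<in> A x" using c by (intro less) (simp add: field_simps)
    hence t: "t > 0" and "inverse (complex_of_real (t / norm c)) *\<^sub>C x \<in> V"
      using c by (auto simp: A_def zero_less_divide_iff)
    hence "(c / norm c) *\<^sub>C (inverse (complex_of_real (t / norm c)) *\<^sub>C x) \<in> V"
      using c by (intro bal[of "c / norm c"]) (auto simp: norm_divide)
    moreover have "(c / norm c) * inverse (complex_of_real (t / norm c)) = inverse (complex_of_real t) * c"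
      using c t by (simp add: field_simps)
    ultimately have "t \<in> A (c *\<^sub>C x)" using t by (simp add: A_def scaleC_scaleC)
    thus "p (c *\<^sub>C x) \<le> t" by (rule le)
  qed
  have p0: "p 0 = 0"
  proof (rule antisym[OF _ nonneg], rule dense_ge)
    fix t :: real assume "0 < t"
    moreover have "0 \<in> V" using V(2) interior_subset by (auto simp: zero_neighborhood_def)
    ultimately show "p 0 \<le> t" by (intro le) (simp add: A_def)
  qed
  have "is_seminorm p"
    unfolding is_seminorm_def
  proof (intro conjI allI nonneg)
    fix x y
    show "p (x + y) \<le> p x + p y"
    proof (rule dense_ge)
      fix u assume "p x + p y < u"
      \<comment> \<open>The slack u - p x - p y is split evenly, so that s + t = u while s and t
        exceed \<open>p x\<close> and \<open>p y\<close>. Then (x + y) / u is the convex combination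
        of x / s and y / t with weights s / u and t / u.\<close>
      define s where "s = p x + (u - p x - p y) / 2"
      define t where "t = p y + (u - p x - p y) / 2"
      have st: "s \<in> A x" "t \<in> A y" "s + t = u"
        using \<open>p x + p y < u\<close> by (auto intro!: less simp: s_def t_def field_simps)
      hence pos: "s > 0" "t > 0" by (auto simp: A_def)
      have "(s / u) *\<^sub>R (inverse (complex_of_real s) *\<^sub>C x) + (t / u) *\<^sub>R (inverse (complex_of_real t) *\<^sub>C y) \<in> V"
        using st pos by (intro convexD[OF V(1)]) (auto simp: A_def simp flip: add_divide_distrib)
      also have "(s / u) *\<^sub>R (inverse (complex_of_real s) *\<^sub>C x) + (t / u) *\<^sub>R (inverse (complex_of_real t) *\<^sub>C y)
         = inverse (complex_of_real u) *\<^sub>C (x + y)"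
        using pos by (simp add: scaleR_scaleC scaleC_scaleC scaleC_add_right field_simps)
      finally have "u \<in> A (x + y)" using pos st by (auto simp: A_def)
      thus "p (x + y) \<le> u" by (rule le)
    qed
  next
    fix c x
    show "p (c *\<^sub>C x) = norm c * p x"
    proof (cases "c = 0")
      case False
      have "p (inverse c *\<^sub>C (c *\<^sub>C x)) \<le> norm (inverse c) * p (c *\<^sub>C x)"
        using False by (intro scale_le) simp
      hence "norm c * p x \<le> p (c *\<^sub>C x)"
        using False by (simp add: scaleC_scaleC scaleC_one norm_inverse norm_divide field_simps)
      with scale_le[OF False] show ?thesis by (intro antisym)
    qed (simp add: p0)
  qed
  moreover have "zero_neighborhood {x. p x \<le> 1}"
    using V(2) by (rule zero_neighborhood_mono) (auto intro!: le simp: A_def scaleC_one)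
  ultimately have "continuous_seminorm p" by (rule continuous_seminormI)
  moreover have "{x. p x < 1} \<subseteq> U"
    using less V(3) by (fastforce simp: A_def scaleC_one)
  ultimately show ?thesis by (rule that)
qed

section \<open>Convergence, continuity and boundedness in terms of seminorms\<close>

lemma tendsto_iff_seminorm:
  fixes l :: "'a::locally_convex_space"
  shows "(f \<longlongrightarrow> l) F \<longleftrightarrow> (\<forall>p. continuous_seminorm p \<longrightarrow> ((\<lambda>y. p (f y - l)) \<longlongrightarrow> 0) F)"
proof safe
  fix p :: "'a \<Rightarrow> real" assume lim: "(f \<longlongrightarrow> l) F" and p: "continuous_seminorm p"
  have lim0: "((\<lambda>y. f y - l) \<longlongrightarrow> 0) F"
    using tendsto_diff[OF lim tendsto_const[of l]] by simp
  show "((\<lambda>y. p (f y - l)) \<longlongrightarrow> 0) F"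
    unfolding tendsto_iff
  proof safe
    fix e :: real assume "e > 0"
    hence "0 \<in> interior {x. p x < e}"
      using p by (simp add: continuous_seminorm_def zero_neighborhood_def)
    with lim0 have "\<forall>\<^sub>F y in F. f y - l \<in> interior {x. p x < e}"
      by (intro topological_tendstoD) auto
    thus "\<forall>\<^sub>F y in F. dist (p (f y - l)) 0 < e"
    proof (rule eventually_mono)
      fix y assume "f y - l \<in> interior {x. p x < e}"
      hence "f y - l \<in> {x. p x < e}" by (rule subsetD[OF interior_subset])
      thus "dist (p (f y - l)) 0 < e"
        using p by (simp add: seminorm_nonneg continuous_seminorm_is_seminorm)
    qed
  qed
next
  assume *: "\<forall>p. continuous_seminorm p \<longrightarrow> ((\<lambda>y. p (f y - l)) \<longlongrightarrow> 0) F"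
  show "(f \<longlongrightarrow> l) F"
  proof (rule topological_tendstoI)
    fix S assume S: "open S" "l \<in> S"
    \<comment> \<open>Translation by \<open>l\<close> moves \<open>S\<close> to a zero neighborhood,
      which contains the unit ball of some continuous seminorm.\<close>
    have "open ((\<lambda>x. x + l) -` S)" using S by (intro open_vimage continuous_intros) auto
    hence "zero_neighborhood ((\<lambda>x. x + l) -` S)"
      using S by (simp add: zero_neighborhood_def interior_open)
    then obtain p where p: "continuous_seminorm p" "{x. p x < 1} \<subseteq> (\<lambda>x. x + l) -` S"
      by (rule continuous_seminorm_below_neighborhood)
    have "\<forall>\<^sub>F y in F. p (f y - l) < 1"
      using * p(1) by (auto intro: order_tendstoD)
    thus "\<forall>\<^sub>F y in F. f y \<in> S"
      by (rule eventually_mono) (use p(2) in auto)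
  qed
qed

text \<open>Pulling a continuous seminorm back along \<open>T\<close> gives a continuous seminorm,
  and T y - T x = T (y - x) carries continuity from zero to x.\<close>

lemma continuous_on_clinearI:
  assumes T: "clinear T"
    and nb: "\<And>V. zero_neighborhood V \<Longrightarrow> zero_neighborhood (T -` V)"
  shows "continuous_on UNIV T"
proof -
  have "(T \<longlongrightarrow> T x) (at x)" for x
    unfolding tendsto_iff_seminorm
  proof safe
    fix p :: "'a \<Rightarrow> real" assume p: "continuous_seminorm p"
    have "zero_neighborhood (T -` {x. p x < 1})"
      using p by (intro nb) (simp add: continuous_seminorm_def)
    hence "continuous_seminorm (\<lambda>x. p (T x))"
      by (intro continuous_seminormI[of _ 1])
        (use p T in \<open>auto elim!: zero_neighborhood_mono intro: seminorm_comp continuous_seminorm_is_seminorm\<close>)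
    thus "(\<lambda>y. p (T y - T x)) \<midarrow>x\<rightarrow> 0"
      using tendsto_iff_seminorm[THEN iffD1, OF tendsto_ident_at, rule_format, of "\<lambda>x. p (T x)" x UNIV]
      by (simp only: clinear_diff[OF T])
  qed
  thus ?thesis by (simp add: continuous_on_def)
qed

lemma continuous_on_clinear_boundI:
  assumes T: "clinear T"
    and bd: "\<And>q. continuous_seminorm q \<Longrightarrow> \<exists>p. continuous_seminorm p \<and> (\<forall>x. q (T x) \<le> p x)"
  shows "continuous_on UNIV T"
proof (rule continuous_on_clinearI[OF T])
  fix V :: "'a set" assume "zero_neighborhood V"
  then obtain q where q: "continuous_seminorm q" "{x. q x < 1} \<subseteq> V"
    by (rule continuous_seminorm_below_neighborhood)
  obtain p where p: "continuous_seminorm p" "\<And>x. q (T x) \<le> p x" using bd[OF q(1)] by auto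
  have "zero_neighborhood {x. p x < 1}" using p by (simp add: continuous_seminorm_def)
  thus "zero_neighborhood (T -` V)"
    by (rule zero_neighborhood_mono) (use p q in \<open>auto intro: order_le_less_trans\<close>)
qed

text \<open>Every zero neighborhood contains the unit ball of a continuous seminorm, so absorption
  need only be tested on such balls, where it is a bound on the seminorm.\<close>

lemma vN_bounded_iff_seminorm:
  fixes B :: "'a::locally_convex_space set"
  shows "vN_bounded B \<longleftrightarrow> (\<forall>p. continuous_seminorm p \<longrightarrow> (\<exists>C. \<forall>x\<in>B. p x \<le> C))"
proof safe
  fix p :: "'a \<Rightarrow> real" assume B: "vN_bounded B" and p: "continuous_seminorm p"
  note sn = continuous_seminorm_is_seminorm[OF p]
  obtain s where s: "s > 0" "\<And>c. norm c \<ge> s \<Longrightarrow> B \<subseteq> (\<lambda>x. c *\<^sub>C x) ` {x. p x < 1}"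
    using B p unfolding vN_bounded_def continuous_seminorm_def by (metis zero_less_one)
  have "p x \<le> s" if "x \<in> B" for x
  proof -
    have "s \<le> norm (complex_of_real s)" using s(1) by simp
    hence "x \<in> (\<lambda>x. complex_of_real s *\<^sub>C x) ` {x. p x < 1}" using s(2) that by (meson subsetD)
    then obtain y where "x = complex_of_real s *\<^sub>C y" "p y < 1" by blast
    thus ?thesis using s by (simp add: seminorm_scale[OF sn])
  qed
  thus "\<exists>C. \<forall>x\<in>B. p x \<le> C" by blast
next
  assume *: "\<forall>p. continuous_seminorm p \<longrightarrow> (\<exists>C. \<forall>x\<in>B. p x \<le> C)"
  show "vN_bounded B"
    unfolding vN_bounded_def
  proof safe
    fix V :: "'a set" assume "zero_neighborhood V"
    then obtain p where p: "continuous_seminorm p" "{x. p x < 1} \<subseteq> V"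
      by (rule continuous_seminorm_below_neighborhood)
    note sn = continuous_seminorm_is_seminorm[OF p(1)]
    obtain C where C: "\<And>x. x \<in> B \<Longrightarrow> p x \<le> C" using * p(1) by blast
    have "x \<in> (\<lambda>x. c *\<^sub>C x) ` V" if c: "norm c \<ge> \<bar>C\<bar> + 1" and x: "x \<in> B" for c x
    proof
      have c0: "c \<noteq> 0" using c by auto
      thus "x = c *\<^sub>C (inverse c *\<^sub>C x)" by (simp add: scaleC_scaleC scaleC_one)
      have "p x < norm c" using C[OF x] c by linarith
      hence "p (inverse c *\<^sub>C x) < 1"
        using c0 by (simp add: seminorm_scale[OF sn] norm_inverse norm_divide field_simps)
      thus "inverse c *\<^sub>C x \<in> V" using p by auto
    qed
    thus "\<exists>s>0. \<forall>c. norm c \<ge> s \<longrightarrow> B \<subseteq> (\<lambda>x. c *\<^sub>C x) ` V"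
      by (intro exI[of _ "\<bar>C\<bar> + 1"]) auto
  qed
qed

section \<open>Locally bounded operators\<close>

text \<open>The constant depends on \<open>q\<close>, but the same \<open>g\<close> serves all
  \<open>q\<close>. For a seminorm \<open>g\<close> this says that its unit ball is mapped to a
  bounded set.\<close>

definition bounded_by :: "('a::locally_convex_space \<Rightarrow> real) \<Rightarrow> ('a \<Rightarrow> 'a) \<Rightarrow> bool" where
  "bounded_by g T \<longleftrightarrow> (\<forall>q. continuous_seminorm q \<longrightarrow> (\<exists>C>0. \<forall>x. q (T x) \<le> C * g x))"

lemma bounded_byD:
  assumes "bounded_by g T" "continuous_seminorm q"
  obtains C where "C > 0" "\<And>x. q (T x) \<le> C * g x"
  using assms unfolding bounded_by_def by blast

lemma bounded_by_mono:
  assumes "bounded_by g T" "\<And>x. g x \<le> h x"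
  shows "bounded_by h T"
  unfolding bounded_by_def
proof safe
  fix q :: "'a \<Rightarrow> real" assume "continuous_seminorm q"
  with assms(1) obtain C where C: "C > 0" "\<And>x. q (T x) \<le> C * g x" by (rule bounded_byD) blast
  have "q (T x) \<le> C * h x" for x
    using C(2)[of x] mult_left_mono[OF assms(2)[of x], of C] C(1) by linarith
  with C(1) show "\<exists>C>0. \<forall>x. q (T x) \<le> C * h x" by blast
qed

text \<open>Take \<open>g\<close> with unit ball inside \<open>U\<close>; homogeneity turns bounds
  on that ball into multiples of \<open>g\<close>. Conversely, the unit ball of \<open>g\<close>
  serves as \<open>U\<close>.\<close>

lemma locally_bounded_op_iff:
  "locally_bounded_op T \<longleftrightarrow> clinear T \<and> (\<exists>g. continuous_seminorm g \<and> bounded_by g T)"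
proof safe
  assume "locally_bounded_op T"
  then obtain U where T: "clinear T" and U: "zero_neighborhood U" "vN_bounded (T ` U)"
    by (auto simp: locally_bounded_op_def)
  show "clinear T" by (rule T)
  obtain g where g: "continuous_seminorm g" "{x. g x < 1} \<subseteq> U"
    using U(1) by (rule continuous_seminorm_below_neighborhood)
  have "bounded_by g T"
    unfolding bounded_by_def
  proof safe
    fix q :: "'a \<Rightarrow> real" assume q: "continuous_seminorm q"
    then obtain C where C: "\<And>x. x \<in> U \<Longrightarrow> q (T x) \<le> C"
      using U(2) unfolding vN_bounded_iff_seminorm by blast
    have "q (T x) \<le> (\<bar>C\<bar> + 1) * g x" for x
    proof (rule bound_on_unit_imp_le_seminorm[of g "\<lambda>x. q (T x)"])
      show "q (T x) \<le> \<bar>C\<bar> + 1" if "g x < 1" for x using C[of x] g(2) that by force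
    qed (use g q T in \<open>auto intro: seminorm_comp continuous_seminorm_is_seminorm\<close>)
    thus "\<exists>C>0. \<forall>x. q (T x) \<le> C * g x" by (intro exI[of _ "\<bar>C\<bar> + 1"]) auto
  qed
  with g(1) show "\<exists>g. continuous_seminorm g \<and> bounded_by g T" by blast
next
  fix g assume T: "clinear T" and g: "continuous_seminorm g" "bounded_by g T"
  have "vN_bounded (T ` {x. g x < 1})"
    unfolding vN_bounded_iff_seminorm
  proof safe
    fix q :: "'a \<Rightarrow> real" assume "continuous_seminorm q"
    with g(2) obtain C where C: "C > 0" "\<And>x. q (T x) \<le> C * g x" by (rule bounded_byD) blast
    have "q (T x) \<le> C" if "g x < 1" for x
      using C(2)[of x] mult_left_mono[of "g x" 1 C] C(1) that by linarith
    thus "\<exists>C. \<forall>y\<in>T ` {x. g x < 1}. q y \<le> C" by blast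
  qed
  with T g(1) show "locally_bounded_op T"
    unfolding locally_bounded_op_def continuous_seminorm_def using zero_less_one by blast
qed

lemma bounded_by_continuous:
  assumes T: "clinear T" and g: "continuous_seminorm g" "bounded_by g T"
  shows "continuous_on UNIV T"
proof (rule continuous_on_clinear_boundI[OF T])
  fix q :: "'a \<Rightarrow> real" assume "continuous_seminorm q"
  with g(2) obtain C where C: "C > 0" "\<And>x. q (T x) \<le> C * g x" by (rule bounded_byD) blast
  thus "\<exists>p. continuous_seminorm p \<and> (\<forall>x. q (T x) \<le> p x)"
    using continuous_seminorm_cmult[OF g(1), of C] by (intro exI[of _ "\<lambda>x. C * g x"]) auto
qed

section \<open>Inclusions between the spectra\<close>

lemma resolvent_in_mono: "A \<subseteq> B \<Longrightarrow> resolvent_in A T \<subseteq> resolvent_in B T"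
  unfolding resolvent_in_def by blast

text \<open>Locally bounded operators are continuous, hence so is each admissible inverse; a
  stricter demand on the inverse enlarges the spectrum.\<close>

lemma spectrum_subset_lb:
  fixes T :: "'a::locally_convex_space \<Rightarrow> 'a"
  shows "spectrum T \<subseteq> spectrum_lb T"
proof -
  have "clinear (\<lambda>x. \<alpha> *\<^sub>C x + S x) \<and> continuous_on UNIV (\<lambda>x. \<alpha> *\<^sub>C x + S x)"
    if S: "locally_bounded_op S" for \<alpha> and S :: "'a \<Rightarrow> 'a"
  proof
    from S obtain g where S: "clinear S" and g: "continuous_seminorm g" "bounded_by g S"
      unfolding locally_bounded_op_iff by blast
    show "clinear (\<lambda>x. \<alpha> *\<^sub>C x + S x)"
      using S by (simp add: clinear_iff scaleC_add_right scaleC_scaleC mult.commute)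
    show "continuous_on UNIV (\<lambda>x. \<alpha> *\<^sub>C x + S x)"
      by (intro continuous_on_add continuous_on_scaleC_left bounded_by_continuous[OF S g])
  qed
  hence "{\<lambda>x. \<alpha> *\<^sub>C x + S x | \<alpha> S. locally_bounded_op S} \<subseteq> {R :: 'a \<Rightarrow> 'a. clinear R \<and> continuous_on UNIV R}"
    by blast
  thus ?thesis unfolding spectrum_def spectrum_lb_def by (simp add: resolvent_in_mono)
qed

text \<open>For each calibration \<open>P\<close> the members of \<open>Q_algebra P\<close> are
  continuous, since p < \<epsilon> / c forces p o R < \<epsilon>. The resulting inclusions for the
  single calibrations survive the intersection.\<close>

lemma spectrum_subset_Q:
  fixes T :: "'a::locally_convex_space \<Rightarrow> 'a"
  shows "spectrum T \<subseteq> spectrum_Q T"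
proof -
  have "clinear R \<and> continuous_on UNIV R" if P: "calibration P" and R: "R \<in> Q_algebra P"
    for P and R :: "'a \<Rightarrow> 'a"
  proof
    show lin: "clinear R" using R by (simp add: Q_algebra_def)
    show "continuous_on UNIV R"
    proof (rule continuous_on_clinearI[OF lin])
      fix V :: "'a set" assume "zero_neighborhood V"
      then obtain F where F: "finite F" "F \<subseteq> P \<times> {0<..}" "(\<Inter>(p, \<epsilon>)\<in>F. {x. p x < \<epsilon>}) \<subseteq> V"
        using P unfolding calibration_def by blast
      have basic: "zero_neighborhood {x. p x < \<epsilon>}" if "p \<in> P" "\<epsilon> > 0" for p \<epsilon>
        using P that unfolding calibration_def by (auto intro!: exI[of _ "{(p, \<epsilon>)}"])
      have "zero_neighborhood (\<Inter>i\<in>F. {x. fst i (R x) < snd i})"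
      proof (rule zero_neighborhood_INT[OF F(1)])
        fix i assume i: "i \<in> F"
        hence i_mem: "fst i \<in> P" "snd i > 0" using F(2) by auto
        then obtain c where c: "c > 0" "\<And>x. fst i (R x) \<le> c * fst i x"
          using R unfolding Q_algebra_def by blast
        have "zero_neighborhood {x. fst i x < snd i / c}"
          using i_mem c by (intro basic) auto
        thus "zero_neighborhood {x. fst i (R x) < snd i}"
        proof (rule zero_neighborhood_mono, safe)
          fix x assume "fst i x < snd i / c"
          thus "fst i (R x) < snd i" using c(1) c(2)[of x] by (simp add: field_simps)
        qed
      qed
      thus "zero_neighborhood (R -` V)"
        by (rule zero_neighborhood_mono) (use F(3) in fastforce)
    qed
  qed
  hence "calibration P \<Longrightarrow> Q_algebra P \<subseteq> {R. clinear R \<and> continuous_on UNIV R}"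
    for P :: "('a \<Rightarrow> real) set"
    by blast
  thus ?thesis
    unfolding spectrum_def spectrum_Q_def spectrum_QP_def
    by (auto dest: resolvent_in_mono[THEN subsetD])
qed

text \<open>Adding \<open>h\<close> to any continuous seminorm lands in this family, so it still
  generates the topology. Its purpose is that an operator bounded by \<open>h\<close> is bounded
  with respect to every one of its members.\<close>

lemma calibration_above:
  assumes h: "continuous_seminorm h"
  shows "calibration {q. continuous_seminorm q \<and> (\<forall>x. h x \<le> q x)}" (is "calibration ?P")
  unfolding calibration_def
proof (intro conjI allI iffI ballI)
  fix p assume "p \<in> ?P" thus "is_seminorm p" by (simp add: continuous_seminorm_def)
next
  fix U :: "'a set" assume "zero_neighborhood U"
  then obtain p where p: "continuous_seminorm p" "{x. p x < 1} \<subseteq> U"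
    by (rule continuous_seminorm_below_neighborhood)
  note nonneg = seminorm_nonneg[OF continuous_seminorm_is_seminorm]
  have "(\<lambda>x. p x + h x) \<in> ?P" using p h nonneg by (auto intro: continuous_seminorm_add)
  moreover have "{x. p x + h x < 1} \<subseteq> {x. p x < 1}"
    using nonneg[OF h] by (smt (verit) Collect_mono)
  with p(2) have "{x. p x + h x < 1} \<subseteq> U" by simp
  ultimately show "\<exists>F. finite F \<and> F \<subseteq> ?P \<times> {0<..} \<and> (\<Inter>(p, \<epsilon>)\<in>F. {x. p x < \<epsilon>}) \<subseteq> U"
    by (intro exI[of _ "{(\<lambda>x. p x + h x, 1)}"]) simp
next
  fix U :: "'a set"
  assume "\<exists>F. finite F \<and> F \<subseteq> ?P \<times> {0<..} \<and> (\<Inter>(p, \<epsilon>)\<in>F. {x. p x < \<epsilon>}) \<subseteq> U"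
  then obtain F where F: "finite F" "F \<subseteq> ?P \<times> {0<..}" "(\<Inter>(p, \<epsilon>)\<in>F. {x. p x < \<epsilon>}) \<subseteq> U"
    by blast
  have "zero_neighborhood (\<Inter>(p, \<epsilon>)\<in>F. {x. p x < \<epsilon>})"
    using F(1,2) by (intro zero_neighborhood_INT) (auto simp: continuous_seminorm_def)
  thus "zero_neighborhood U" using F(3) by (rule zero_neighborhood_mono)
qed

section \<open>The Neumann series\<close>

lemma seminorm_funpow_le:
  fixes g :: "'a \<Rightarrow> real"
  assumes "\<And>x. g (T x) \<le> \<tau> * g x" "\<tau> \<ge> 0"
  shows "g ((T ^^ n) x) \<le> \<tau> ^ n * g x"
proof (induction n)
  case (Suc n)
  have "g ((T ^^ Suc n) x) \<le> \<tau> * g ((T ^^ n) x)" using assms(1) by simp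
  also have "\<dots> \<le> \<tau> * (\<tau> ^ n * g x)" using Suc assms(2) by (rule mult_left_mono)
  finally show ?case by (simp add: mult.assoc)
qed simp

text \<open>Uniform convergence bounds g (T^n x) by \<nu>^n p x for all large n, and the finitely
  many other powers are absorbed into a constant and into h = p + g. One further factor T passes
  from \<open>g\<close> to an arbitrary \<open>q\<close>, which explains
  \<open>Suc n\<close>.\<close>

lemma uniformly_to_zero_imp_growth:
  fixes T :: "'a::locally_convex_space \<Rightarrow> 'a"
  assumes T: "clinear T" and g: "continuous_seminorm g" "bounded_by g T"
    and \<nu>: "\<nu> > 0" and U: "zero_neighborhood U"
    and lim: "uniformly_to_zero_on U (\<lambda>n x. (T ^^ n) x /\<^sub>R \<nu> ^ n)"
  obtains h where "continuous_seminorm h" "\<And>x. g x \<le> h x"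
    "\<And>q. continuous_seminorm q \<Longrightarrow> \<exists>C>0. \<forall>n x. q ((T ^^ Suc n) x) \<le> C * \<nu> ^ n * h x"
proof -
  note sg = continuous_seminorm_is_seminorm[OF g(1)]
  obtain p where p: "continuous_seminorm p" "{x. p x < 1} \<subseteq> U"
    using U by (rule continuous_seminorm_below_neighborhood)
  note sp = continuous_seminorm_is_seminorm[OF p(1)]
  have "zero_neighborhood {x. g x < 1}" using g(1) by (simp add: continuous_seminorm_def)
  then obtain n0 where n0: "\<And>n. n \<ge> n0 \<Longrightarrow> (\<lambda>x. (T ^^ n) x /\<^sub>R \<nu> ^ n) ` U \<subseteq> {x. g x < 1}"
    using lim unfolding uniformly_to_zero_on_def by blast
  have large: "g ((T ^^ n) x) \<le> \<nu> ^ n * p x" if n: "n \<ge> n0" for n x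
  proof (rule bound_on_unit_imp_le_seminorm[of p "\<lambda>x. g ((T ^^ n) x)"])
    fix x assume "p x < 1"
    hence "g ((T ^^ n) x /\<^sub>R \<nu> ^ n) < 1" using n0[OF n] p(2) by blast
    thus "g ((T ^^ n) x) \<le> \<nu> ^ n"
      using \<nu> by (simp add: scaleR_scaleC seminorm_scale[OF sg] norm_inverse norm_divide norm_power field_simps)
  qed (use sp sg in \<open>auto intro: seminorm_comp clinear_funpow T\<close>)
  obtain \<tau> where \<tau>: "\<tau> > 0" "\<And>x. g (T x) \<le> \<tau> * g x" using g by (metis bounded_byD)
  \<comment> \<open>The 1 covers n \<ge> n0; for n < n0 the sum contains (\<tau> / \<nu>)^n as one
    of its terms.\<close>
  define D where "D = 1 + (\<Sum>k<n0. (\<tau> / \<nu>) ^ k)"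
  define h where "h x = p x + g x" for x
  have D: "D \<ge> 1" using \<tau> \<nu> by (auto simp: D_def intro!: sum_nonneg)
  have h: "continuous_seminorm h"
    unfolding h_def using p(1) g(1) by (rule continuous_seminorm_add)
  have nonneg: "p x \<ge> 0" "g x \<ge> 0" for x using sp sg by (simp_all add: seminorm_nonneg)
  have growth: "g ((T ^^ n) x) \<le> D * \<nu> ^ n * h x" for n x
  proof (cases "n \<ge> n0")
    case True
    have "g ((T ^^ n) x) \<le> 1 * \<nu> ^ n * p x" using large[OF True] by simp
    also have "\<dots> \<le> D * \<nu> ^ n * h x"
      using D \<nu> nonneg by (intro mult_mono) (auto simp: h_def)
    finally show ?thesis .
  next
    case False
    have "(\<tau> / \<nu>) ^ n \<le> (\<Sum>k<n0. (\<tau> / \<nu>) ^ k)"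
      using False \<tau> \<nu> by (intro member_le_sum) auto
    hence "(\<tau> / \<nu>) ^ n \<le> D" by (simp add: D_def)
    hence "\<tau> ^ n \<le> D * \<nu> ^ n" using \<nu> by (simp add: power_divide field_simps)
    moreover have "g ((T ^^ n) x) \<le> \<tau> ^ n * g x"
      using \<tau> by (intro seminorm_funpow_le) auto
    ultimately show ?thesis
      using nonneg D \<nu> by (elim order_trans) (auto intro!: mult_mono simp: h_def)
  qed
  have "\<exists>C>0. \<forall>n x. q ((T ^^ Suc n) x) \<le> C * \<nu> ^ n * h x" if q: "continuous_seminorm q" for q
  proof -
    obtain C where C: "C > 0" "\<And>x. q (T x) \<le> C * g x" using g(2) q by (metis bounded_byD)
    have "q ((T ^^ Suc n) x) \<le> C * D * \<nu> ^ n * h x" for n x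
    proof -
      have "q ((T ^^ Suc n) x) \<le> C * g ((T ^^ n) x)" using C(2) by simp
      also have "\<dots> \<le> C * (D * \<nu> ^ n * h x)" using C(1) growth by (intro mult_left_mono) auto
      finally show ?thesis by (simp add: mult.assoc)
    qed
    with C(1) D show ?thesis by (intro exI[of _ "C * D"]) auto
  qed
  with h show ?thesis using nonneg by (intro that[of h]) (auto simp: h_def)
qed

text \<open>The terms decay like (\<nu> / |z|)^n in every seminorm, with the common factor
  \<open>h x\<close>. The term I / z is split off because the identity need not be locally bounded;
  the remainder \<open>S\<close> is bounded by \<open>h\<close>.\<close>

lemma neumann_series:
  fixes T :: "'a::locally_convex_space \<Rightarrow> 'a"
  assumes complete: "seq_complete (UNIV :: 'a set)"
    and T: "clinear T" "continuous_on UNIV T"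
    and h: "continuous_seminorm h"
    and growth: "\<And>q. continuous_seminorm q \<Longrightarrow>
      \<exists>C>0. \<forall>n x. q ((T ^^ Suc n) x) \<le> C * \<nu> ^ n * h x"
    and \<nu>: "0 < \<nu>" "\<nu> < norm z"
  obtains S where "clinear S" "bounded_by h S"
    "\<And>x. inverse z *\<^sub>C (z *\<^sub>C x - T x) + S (z *\<^sub>C x - T x) = x"
    "\<And>x. z *\<^sub>C (inverse z *\<^sub>C x + S x) - T (inverse z *\<^sub>C x + S x) = x"
proof -
  have z: "z \<noteq> 0" using \<nu> by auto
  note sh = continuous_seminorm_is_seminorm[OF h]
  \<comment> \<open>This is z^-(k+1) T^k at k = n + 1, so the growth bound for \<open>Suc n\<close>
    applies to it directly.\<close>
  define a where "a n x = inverse z ^ (n + 2) *\<^sub>C (T ^^ Suc n) x" for n x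
  define s where "s n x = (\<Sum>k<n. a k x)" for n x
  define \<rho> where "\<rho> = \<nu> / norm z"
  have \<rho>: "0 < \<rho>" "\<rho> < 1" using \<nu> z by (simp_all add: \<rho>_def)
  have term_bound: "\<exists>C>0. \<forall>n x. q (a n x) \<le> C * h x * \<rho> ^ n" if q: "continuous_seminorm q" for q
  proof -
    obtain C where C: "C > 0" "\<And>n x. q ((T ^^ Suc n) x) \<le> C * \<nu> ^ n * h x"
      using growth[OF q] by blast
    have "q (a n x) \<le> C / norm z ^ 2 * h x * \<rho> ^ n" for n x
    proof -
      have "q (a n x) = inverse (norm z) ^ (n + 2) * q ((T ^^ Suc n) x)"
        unfolding a_def seminorm_scale[OF continuous_seminorm_is_seminorm[OF q]]
        by (simp add: norm_power norm_inverse norm_mult)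
      also have "\<dots> \<le> inverse (norm z) ^ (n + 2) * (C * \<nu> ^ n * h x)"
        by (intro mult_left_mono C(2)) auto
      also have "\<dots> = C / norm z ^ 2 * h x * \<rho> ^ n"
        using z by (simp add: \<rho>_def power_divide power_add field_simps power2_eq_square)
      finally show ?thesis .
    qed
    with C(1) z show ?thesis by (intro exI[of _ "C / norm z ^ 2"]) auto
  qed
  have geom: "(\<Sum>k\<in>{m..<n}. \<rho> ^ k) \<le> \<rho> ^ m / (1 - \<rho>)" for m n
  proof -
    have "(\<Sum>k\<in>{m..<n}. \<rho> ^ k) = (\<Sum>k\<in>{0..<n - m}. \<rho> ^ (k + m))"
      by (cases "m \<le> n") (auto simp: sum.atLeastLessThan_shift_0[of _ m n] add.commute)
    also have "\<dots> = \<rho> ^ m * (\<Sum>k<n - m. \<rho> ^ k)"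
      by (simp add: power_add sum_distrib_left mult.commute lessThan_atLeast0)
    also have "(\<Sum>k<n - m. \<rho> ^ k) \<le> 1 / (1 - \<rho>)"
      using \<rho> by (simp add: sum_gp_strict divide_right_mono)
    finally show ?thesis using \<rho> by (simp add: mult_left_mono)
  qed
  have tail: "q (s n x - s m x) \<le> (\<Sum>k\<in>{m..<n}. q (a k x))"
    if "continuous_seminorm q" "m \<le> n" for q m n x
  proof -
    have "s n x - s m x = (\<Sum>k\<in>{m..<n}. a k x)"
      using that(2) sum_diff_nat_ivl[of 0 m n "\<lambda>k. a k x"] by (simp add: s_def lessThan_atLeast0)
    thus ?thesis using seminorm_sum[OF continuous_seminorm_is_seminorm[OF that(1)]] by simp
  qed
  have partial: "\<exists>C>0. \<forall>m n x. m \<le> n \<longrightarrow> q (s n x - s m x) \<le> C * h x * \<rho> ^ m"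
    if q: "continuous_seminorm q" for q
  proof -
    obtain C where C: "C > 0" "\<And>n x. q (a n x) \<le> C * h x * \<rho> ^ n" using term_bound[OF q] by blast
    have "q (s n x - s m x) \<le> C / (1 - \<rho>) * h x * \<rho> ^ m" if "m \<le> n" for m n x
    proof -
      have "q (s n x - s m x) \<le> (\<Sum>k\<in>{m..<n}. C * h x * \<rho> ^ k)"
        using tail[OF q that] sum_mono[of "{m..<n}", OF C(2)] by (rule order_trans)
      also have "\<dots> = C * h x * (\<Sum>k\<in>{m..<n}. \<rho> ^ k)" by (simp add: sum_distrib_left)
      also have "\<dots> \<le> C * h x * (\<rho> ^ m / (1 - \<rho>))"
        using C(1) by (intro mult_left_mono geom) (simp add: seminorm_nonneg[OF sh])
      finally show ?thesis by simp
    qed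
    with C(1) \<rho> show ?thesis by (intro exI[of _ "C / (1 - \<rho>)"]) auto
  qed
  have "\<exists>l. (\<lambda>n. s n x) \<longlonglongrightarrow> l" for x
  proof -
    have "lcs_Cauchy (\<lambda>n. s n x)"
      unfolding lcs_Cauchy_def
    proof safe
      fix V :: "'a set" assume "zero_neighborhood V"
      then obtain q where q: "continuous_seminorm q" "{x. q x < 1} \<subseteq> V"
        by (rule continuous_seminorm_below_neighborhood)
      note sq = continuous_seminorm_is_seminorm[OF q(1)]
      obtain C where C: "\<And>m n. m \<le> n \<Longrightarrow> q (s n x - s m x) \<le> C * h x * \<rho> ^ m"
        using partial[OF q(1)] by blast
      have "(\<lambda>m. C * h x * \<rho> ^ m) \<longlonglongrightarrow> C * h x * 0"
        using \<rho> by (intro tendsto_mult tendsto_const LIMSEQ_realpow_zero) auto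
      hence "\<forall>\<^sub>F m in sequentially. C * h x * \<rho> ^ m < 1" by (rule order_tendstoD) simp
      then obtain N where N: "\<And>m. m \<ge> N \<Longrightarrow> C * h x * \<rho> ^ m < 1"
        by (auto simp: eventually_sequentially)
      have "q (s m x - s n x) < 1" if "m \<ge> N" "n \<ge> N" for m n
        using C[of m n] C[of n m] N[of m] N[of n] that seminorm_minus_commute[OF sq, of "s m x" "s n x"]
        by (cases "m \<le> n") auto
      thus "\<exists>N. \<forall>m\<ge>N. \<forall>n\<ge>N. s m x - s n x \<in> V" using q(2) by blast
    qed
    thus ?thesis using complete unfolding seq_complete_def by auto
  qed
  then obtain S where S: "\<And>x. (\<lambda>n. s n x) \<longlonglongrightarrow> S x" by metis
  have isCont_T: "(\<lambda>n. T (f n)) \<longlonglongrightarrow> T l" if "f \<longlonglongrightarrow> l" for f l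
    using continuous_on_tendsto_compose[OF T(2) that] by simp
  have isCont_scale: "(\<lambda>n. c *\<^sub>C f n) \<longlonglongrightarrow> c *\<^sub>C l" if "f \<longlonglongrightarrow> l" for f c and l :: 'a
    using continuous_on_tendsto_compose[OF continuous_on_scaleC_left that] by simp
  have lin_a: "clinear (a n)" for n
    using clinear_funpow[OF T(1), of "Suc n"] unfolding a_def
    by (simp only: clinear_iff) (simp add: scaleC_add_right scaleC_scaleC mult.commute del: funpow.simps)
  have lin_s: "s n (x + y) = s n x + s n y" "s n (c *\<^sub>C x) = c *\<^sub>C s n x" for n x y c
    by (simp_all add: s_def clinear_add[OF lin_a] clinear_scale[OF lin_a] sum.distrib cvec.scale_sum_right)
  have lin: "clinear S"
    unfolding clinear_iff
  proof safe
    fix x y show "S (x + y) = S x + S y"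
      using LIMSEQ_unique[OF S[of "x + y"]] tendsto_add[OF S[of x] S[of y]] by (simp add: lin_s)
    fix c show "S (c *\<^sub>C x) = c *\<^sub>C S x"
      using LIMSEQ_unique[OF S[of "c *\<^sub>C x"]] isCont_scale[OF S[of x], of c] by (simp add: lin_s)
  qed
  have S_T: "S (T x) = T (S x)" for x
  proof -
    have "T (a k x) = a k (T x)" for k
      by (simp add: a_def clinear_scale[OF T(1)] funpow_swap1)
    hence "T (s n x) = s n (T x)" for n by (simp add: s_def clinear_sum[OF T(1)])
    thus ?thesis using LIMSEQ_unique[OF S[of "T x"]] isCont_T[OF S[of x]] by simp
  qed
  \<comment> \<open>Applying T / z shifts the Neumann series by one index. In the limit T R = z S
    for R = I / z + S, which is (z I - T) R = I.\<close>
  have telescope: "T (inverse z *\<^sub>C x + s n x) = z *\<^sub>C s (Suc n) x" for n x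
  proof (induction n)
    case 0
    show ?case using z by (simp add: s_def a_def clinear_scale[OF T(1)] scaleC_scaleC power2_eq_square)
  next
    case (Suc n)
    have "T (inverse z *\<^sub>C x + s (Suc n) x) = T (inverse z *\<^sub>C x + s n x) + T (a n x)"
      by (simp add: s_def clinear_add[OF T(1)] add.assoc)
    also have "T (a n x) = z *\<^sub>C a (Suc n) x"
      using z by (simp add: a_def clinear_scale[OF T(1)] scaleC_scaleC)
    finally show ?case using Suc by (simp add: s_def scaleC_add_right)
  qed
  have right: "z *\<^sub>C (inverse z *\<^sub>C x + S x) - T (inverse z *\<^sub>C x + S x) = x" for x
  proof -
    have "(\<lambda>n. T (inverse z *\<^sub>C x + s n x)) \<longlonglongrightarrow> T (inverse z *\<^sub>C x + S x)"
      by (intro isCont_T tendsto_add tendsto_const S)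
    moreover have "(\<lambda>n. z *\<^sub>C s (Suc n) x) \<longlonglongrightarrow> z *\<^sub>C S x"
      using isCont_scale[OF S] by (rule LIMSEQ_Suc)
    ultimately have "T (inverse z *\<^sub>C x + S x) = z *\<^sub>C S x"
      unfolding telescope by (rule LIMSEQ_unique)
    thus ?thesis using z by (simp add: scaleC_add_right scaleC_scaleC scaleC_one)
  qed
  \<comment> \<open>The right inverse is also a left inverse because \<open>S\<close> commutes with
    \<open>T\<close>.\<close>
  have left: "inverse z *\<^sub>C (z *\<^sub>C x - T x) + S (z *\<^sub>C x - T x) = x" for x
    using right[of x] z
    by (simp add: clinear_diff[OF lin] clinear_scale[OF lin] clinear_add[OF T(1)] clinear_scale[OF T(1)]
        S_T cvec.scale_right_diff_distrib scaleC_add_right scaleC_scaleC scaleC_one algebra_simps)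
  have "bounded_by h S"
    unfolding bounded_by_def
  proof safe
    fix q :: "'a \<Rightarrow> real" assume q: "continuous_seminorm q"
    note sq = continuous_seminorm_is_seminorm[OF q]
    obtain C where C: "C > 0" "\<And>m n x. m \<le> n \<Longrightarrow> q (s n x - s m x) \<le> C * h x * \<rho> ^ m"
      using partial[OF q] by blast
    have "q (S x) \<le> C * h x" for x
    proof (rule tendsto_lowerbound)
      show "(\<lambda>n. C * h x + q (s n x - S x)) \<longlonglongrightarrow> C * h x"
        using tendsto_add[OF tendsto_const tendsto_iff_seminorm[THEN iffD1, OF S, rule_format, OF q]]
        by fastforce
      \<comment> \<open>The partial sum estimate is used with m = 0, where \<open>s 0 x\<close> is
        the empty sum.\<close>
      have "q (S x) \<le> C * h x + q (s n x - S x)" for n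
        using seminorm_triangle_diff[OF sq, of "s n x" "s n x - S x"] C(2)[of 0 n x]
        by (simp add: s_def)
      thus "\<forall>\<^sub>F n in sequentially. q (S x) \<le> C * h x + q (s n x - S x)" by simp
    qed simp
    with C(1) show "\<exists>C>0. \<forall>x. q (S x) \<le> C * h x" by blast
  qed
  from that[OF lin this left right] show ?thesis .
qed

text \<open>The same operator R = I / z + S witnesses both claims: it has the form demanded by
  \<open>spectrum_lb\<close>, and it lies in the algebra of the calibration above \<open>h\<close>,
  which contains \<open>T\<close> too.\<close>

lemma resolvent_outside_r_lb:
  fixes T :: "'a::locally_convex_space \<Rightarrow> 'a"
  assumes complete: "seq_complete (UNIV :: 'a set)"
    and T: "locally_bounded_op T" and z: "r_lb T < ennreal (norm z)"
  shows "z \<notin> spectrum_lb T \<and> z \<notin> spectrum_Q T"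
proof -
  obtain g where lin: "clinear T" and g: "continuous_seminorm g" "bounded_by g T"
    using T unfolding locally_bounded_op_iff by blast
  obtain \<nu> U where \<nu>: "\<nu> > 0" "ennreal \<nu> < ennreal (norm z)" and U: "zero_neighborhood U"
    "uniformly_to_zero_on U (\<lambda>n x. (T ^^ n) x /\<^sub>R \<nu> ^ n)"
    using z unfolding r_lb_def Inf_less_iff by blast
  have \<nu>_less: "\<nu> < norm z" using \<nu> by (simp add: ennreal_less_iff)
  obtain h where h: "continuous_seminorm h" "\<And>x. g x \<le> h x"
    and growth: "\<And>q. continuous_seminorm q \<Longrightarrow> \<exists>C>0. \<forall>n x. q ((T ^^ Suc n) x) \<le> C * \<nu> ^ n * h x"
    using uniformly_to_zero_imp_growth[OF lin g \<nu>(1) U] by metis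
  obtain S where S: "clinear S" "bounded_by h S"
    and inv: "\<And>x. inverse z *\<^sub>C (z *\<^sub>C x - T x) + S (z *\<^sub>C x - T x) = x"
      "\<And>x. z *\<^sub>C (inverse z *\<^sub>C x + S x) - T (inverse z *\<^sub>C x + S x) = x"
    using neumann_series[OF complete lin bounded_by_continuous[OF lin g] h(1) growth \<nu>(1) \<nu>_less] by metis
  define R where "R x = inverse z *\<^sub>C x + S x" for x
  have in_resolvent: "z \<in> resolvent_in A T" if "R \<in> A" for A
    using that inv[folded R_def] unfolding resolvent_in_def by blast
  have "locally_bounded_op S" using S h(1) unfolding locally_bounded_op_iff by blast
  hence "R \<in> {\<lambda>x. \<alpha> *\<^sub>C x + S x | \<alpha> S. locally_bounded_op S}"
    by (intro CollectI exI[of _ "inverse z"] exI[of _ S] conjI) (simp_all add: R_def[abs_def])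
  hence "z \<notin> spectrum_lb T" using in_resolvent by (simp add: spectrum_lb_def)
  moreover have "z \<notin> spectrum_Q T"
  proof -
    define P where "P = {q. continuous_seminorm q \<and> (\<forall>x. h x \<le> q x)}"
    \<comment> \<open>For q above \<open>h\<close>, q (A x) \<le> C h x \<le> C q x. The scalar c =
      0 gives \<open>T\<close> and c = 1 / z gives the resolvent.\<close>
    have in_Q: "(\<lambda>x. c *\<^sub>C x + A x) \<in> Q_algebra P" if A: "clinear A" "bounded_by h A" for A c
      unfolding Q_algebra_def
    proof safe
      show "clinear (\<lambda>x. c *\<^sub>C x + A x)"
        using A(1) by (simp add: clinear_iff scaleC_add_right scaleC_scaleC mult.commute)
      fix q assume "q \<in> P"
      hence q: "continuous_seminorm q" "\<And>x. h x \<le> q x" by (auto simp: P_def)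
      note sq = continuous_seminorm_is_seminorm[OF q(1)]
      obtain C where C: "C > 0" "\<And>x. q (A x) \<le> C * h x" using A(2) q(1) by (metis bounded_byD)
      have "q (c *\<^sub>C x + A x) \<le> (norm c + C) * q x" for x
      proof -
        have "q (c *\<^sub>C x + A x) \<le> norm c * q x + q (A x)"
          using seminorm_triangle[OF sq, of "c *\<^sub>C x" "A x"] by (simp add: seminorm_scale[OF sq])
        also have "q (A x) \<le> C * q x"
          using C(2)[of x] mult_left_mono[OF q(2)[of x], of C] C(1) by linarith
        finally show ?thesis by (simp add: distrib_right)
      qed
      thus "\<exists>d>0. \<forall>x. q (c *\<^sub>C x + A x) \<le> d * q x"
        using C(1) by (intro exI[of _ "norm c + C"]) (auto simp: add_nonneg_pos)
    qed
    have "T \<in> Q_algebra P" using in_Q[OF lin bounded_by_mono[OF g(2) h(2)], of 0] by simp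
    moreover have "R \<in> Q_algebra P" using in_Q[OF S, of "inverse z"] by (simp add: R_def[abs_def])
    moreover have "calibration P" unfolding P_def using h(1) by (rule calibration_above)
    moreover have "z \<notin> spectrum_QP P T"
      using in_resolvent[OF \<open>R \<in> Q_algebra P\<close>] by (simp add: spectrum_QP_def)
    ultimately show ?thesis unfolding spectrum_Q_def by blast
  qed
  ultimately show ?thesis ..
qed

section \<open>Growth of the powers and the resolvent\<close>

text \<open>A geometric sum whose ratio \<omega>^k differs from 1, since N does not divide k, while
  its N-th power is 1.\<close>

lemma sum_roots_unity_power:
  assumes "0 < k" "k < N"
  shows "(\<Sum>j<N. cis (2 * pi / N) ^ (j * k)) = 0"
proof -
  define \<omega> where "\<omega> = cis (2 * pi / N) ^ k"
  have \<omega>_exp: "\<omega> = exp (2 * of_real pi * \<i> * of_nat k / of_nat N)"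
    by (simp add: \<omega>_def cis_conv_exp mult_ac flip: exp_of_nat_mult)
  have "\<omega> \<noteq> 1" unfolding \<omega>_exp using assms complex_root_unity_eq_1[of N k] by (auto dest: dvd_imp_le)
  moreover have "\<omega> ^ N = 1"
    unfolding \<omega>_exp using assms complex_root_unity[of N k] by simp
  moreover have "cis (2 * pi / N) ^ (j * k) = \<omega> ^ j" for j
    by (simp add: \<omega>_def mult.commute flip: power_mult)
  ultimately show ?thesis by (simp add: geometric_sum)
qed

text \<open>For a seminorm \<open>g\<close> this says that the operator seminorms of s^n T^n
  relative to \<open>g\<close> tend to zero.\<close>

definition powers_decay :: "('a \<Rightarrow> real) \<Rightarrow> ('a \<Rightarrow> 'a) \<Rightarrow> real \<Rightarrow> bool" where
  "powers_decay g T s \<longleftrightarrow> (\<forall>\<epsilon>>0. \<exists>n0. \<forall>n\<ge>n0. \<forall>x. s ^ n * g ((T ^^ n) x) \<le> \<epsilon> * g x)"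

section \<open>Inverses of I - w T on a closed disc, measured by one seminorm\<close>

context
  fixes g :: "'a::complex_vector \<Rightarrow> real" and T :: "'a \<Rightarrow> 'a"
    and F :: "complex \<Rightarrow> 'a \<Rightarrow> 'a" and r \<tau> :: real
  assumes g: "is_seminorm g" and T: "clinear T" and \<tau>: "\<tau> > 0" "\<And>x. g (T x) \<le> \<tau> * g x"
    and linF: "\<And>w. norm w \<le> r \<Longrightarrow> clinear (F w)"
    and left: "\<And>w x. norm w \<le> r \<Longrightarrow> F w (x - w *\<^sub>C T x) = x"
    and right: "\<And>w x. norm w \<le> r \<Longrightarrow> F w x - w *\<^sub>C T (F w x) = x"
    and bdF: "\<And>w. norm w \<le> r \<Longrightarrow> \<exists>C. \<forall>x. g (F w x) \<le> C * g x"
begin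

text \<open>With y = F w x, write x = (I - v T) y + (v - w) T y and apply
  \<open>F v\<close>.\<close>

lemma resolvent_identity:
  assumes "norm v \<le> r" "norm w \<le> r"
  shows "F v x - F w x = (v - w) *\<^sub>C F v (T (F w x))"
proof -
  define y where "y = F w x"
  have "x = (y - v *\<^sub>C T y) + (v - w) *\<^sub>C T y"
    using right[OF assms(2), of x] by (simp add: y_def cvec.scale_left_diff_distrib)
  hence "F v x = F v ((y - v *\<^sub>C T y) + (v - w) *\<^sub>C T y)" by simp
  also have "\<dots> = y + (v - w) *\<^sub>C F v (T y)"
    using assms(1) by (simp only: clinear_add[OF linF] clinear_scale[OF linF] left)
  finally show ?thesis by (simp add: y_def)
qed

text \<open>Each \<open>F w\<close> is bounded with a constant of its own. The resolvent identity
  carries the bound, doubled, to nearby points, and compactness of the disc leaves finitely many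
  constants.\<close>

lemma resolvent_uniformly_bounded:
  obtains M where "M > 0" "\<And>w x. norm w \<le> r \<Longrightarrow> g (F w x) \<le> M * g x"
proof -
  have "\<exists>d C. d > 0 \<and> C > 0 \<and> (\<forall>v\<in>ball w d. norm v \<le> r \<longrightarrow> (\<forall>x. g (F v x) \<le> C * g x))"
    if w: "norm w \<le> r" for w
  proof -
    obtain C0 where C0: "\<And>x. g (F w x) \<le> C0 * g x" using bdF[OF w] by blast
    define C where "C = \<bar>C0\<bar> + 1"
    have "C > 0" "C0 \<le> C" by (simp_all add: C_def)
    hence C: "C > 0" "g (F w x) \<le> C * g x" for x
      using order_trans[OF C0[of x] mult_right_mono[OF _ seminorm_nonneg[OF g]], of C] by simp_all
    \<comment> \<open>This radius makes |w - v| C \<tau> \<le> 1 / 2, so half of g (F v x) can be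
      absorbed on the left.\<close>
    define d where "d = 1 / (2 * C * \<tau>)"
    have "g (F v x) \<le> 2 * C * g x" if v: "norm v \<le> r" "v \<in> ball w d" for v x
    proof -
      have "norm (w - v) * (C * \<tau>) \<le> d * (C * \<tau>)"
        using v(2) C(1) \<tau>(1) by (intro mult_right_mono) (auto simp: dist_norm)
      hence half: "norm (w - v) * (C * \<tau>) \<le> 1 / 2" using C(1) \<tau>(1) by (simp add: d_def)
      have "F v x = F w x - (w - v) *\<^sub>C F w (T (F v x))"
        using resolvent_identity[OF w v(1), of x] by (simp add: algebra_simps)
      hence "g (F v x) \<le> g (F w x) + norm (w - v) * g (F w (T (F v x)))"
        using seminorm_triangle_diff[OF g] by (metis seminorm_scale[OF g])
      also have "\<dots> \<le> C * g x + norm (w - v) * (C * (\<tau> * g (F v x)))"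
        using C \<tau> by (intro add_mono mult_left_mono order_trans[OF C(2)]) auto
      also have "\<dots> = C * g x + norm (w - v) * (C * \<tau>) * g (F v x)" by simp
      also have "\<dots> \<le> C * g x + 1 / 2 * g (F v x)"
        by (intro add_left_mono mult_right_mono half seminorm_nonneg[OF g])
      finally show ?thesis by simp
    qed
    moreover have "d > 0" using C(1) \<tau>(1) by (simp add: d_def)
    ultimately show ?thesis using C(1) by (intro exI[of _ d] exI[of _ "2 * C"]) auto
  qed
  then obtain d C where dC: "\<And>w. norm w \<le> r \<Longrightarrow> d w > 0 \<and> C w > (0::real) \<and>
      (\<forall>v\<in>ball w (d w). norm v \<le> r \<longrightarrow> (\<forall>x. g (F v x) \<le> C w * g x))"
    by metis
  have "compact (cball (0::complex) r)" by simp
  then obtain I where I: "I \<subseteq> cball 0 r" "finite I" "cball 0 r \<subseteq> (\<Union>w\<in>I. ball w (d w))"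
    by (rule compactE_image[of _ "cball 0 r" "\<lambda>w. ball w (d w)"]) (use dC in auto)
  define M where "M = 1 + (\<Sum>w\<in>I. C w)"
  have pos: "C w > 0" if "w \<in> I" for w using I(1) dC[of w] that by auto
  have "g (F v x) \<le> M * g x" if v: "norm v \<le> r" for v x
  proof -
    obtain w where w: "w \<in> I" "v \<in> ball w (d w)" using I(3) v by auto
    have "norm w \<le> r" using w I(1) by auto
    hence le: "g (F v x) \<le> C w * g x" using dC w(2) v by blast
    have "C w \<le> (\<Sum>w\<in>I. C w)"
      using pos w(1) I(2) by (intro member_le_sum) (auto intro: less_imp_le)
    also have "\<dots> \<le> M" by (simp add: M_def)
    finally have "C w * g x \<le> M * g x" by (intro mult_right_mono seminorm_nonneg[OF g])
    with le show ?thesis by (rule order_trans)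
  qed
  moreover have "M > 0" using sum_nonneg[of I C] pos by (force simp: M_def less_imp_le)
  ultimately show ?thesis by (rule that[rotated])
qed

text \<open>Applying \<open>F v\<close> to both sides shows that F v (x - v^N T^N x) is a finite
  geometric sum.\<close>

lemma clinear_telescope:
  "(\<Sum>k<N. v ^ k *\<^sub>C (T ^^ k) x) - v *\<^sub>C T (\<Sum>k<N. v ^ k *\<^sub>C (T ^^ k) x) = x - v ^ N *\<^sub>C (T ^^ N) x"
proof (induction N)
  case (Suc N)
  have "v *\<^sub>C T (v ^ N *\<^sub>C (T ^^ N) x) = v ^ Suc N *\<^sub>C (T ^^ Suc N) x"
    by (simp add: clinear_scale[OF T] scaleC_scaleC)
  hence "(\<Sum>k<Suc N. v ^ k *\<^sub>C (T ^^ k) x) - v *\<^sub>C T (\<Sum>k<Suc N. v ^ k *\<^sub>C (T ^^ k) x)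
      = ((\<Sum>k<N. v ^ k *\<^sub>C (T ^^ k) x) - v *\<^sub>C T (\<Sum>k<N. v ^ k *\<^sub>C (T ^^ k) x))
        + (v ^ N *\<^sub>C (T ^^ N) x - v ^ Suc N *\<^sub>C (T ^^ Suc N) x)"
    by (simp only: sum.lessThan_Suc clinear_add[OF T] scaleC_add_right) simp
  thus ?case by (simp only: Suc) simp
qed (simp add: clinear_zero[OF T] scaleC_one)

text \<open>All sample points have modulus s for s \<ge> 0, so they stay in the disc where
  \<open>F\<close> is controlled. Averaging over roots of unity removes the powers of T with
  exponents between 0 and N.\<close>

definition resolvent_mean :: "nat \<Rightarrow> real \<Rightarrow> 'a \<Rightarrow> 'a" where
  "resolvent_mean N s x = (1 / of_nat N) *\<^sub>C (\<Sum>j<N. F (complex_of_real s * cis (2 * pi / N) ^ j) x)"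

text \<open>The operator version of the partial fraction decomposition of \<open>1 / (1 - s\<^sup>N t\<^sup>N)\<close>.\<close>

lemma resolvent_mean_left_inverse:
  assumes N: "N > 0" and s: "0 \<le> s" "s \<le> r"
  shows "resolvent_mean N s (x - complex_of_real s ^ N *\<^sub>C (T ^^ N) x) = x"
proof -
  define \<omega> where "\<omega> = cis (2 * pi / N)"
  have "real N * (2 * pi / real N) = 2 * pi" using N by simp
  hence \<omega>N: "\<omega> ^ N = 1" by (simp only: \<omega>_def Complex.DeMoivre cis_2pi)
  have "F (complex_of_real s * \<omega> ^ j) (x - complex_of_real s ^ N *\<^sub>C (T ^^ N) x)
      = (\<Sum>k<N. (complex_of_real s ^ k * \<omega> ^ (j * k)) *\<^sub>C (T ^^ k) x)" for j
  proof -
    define v where "v = complex_of_real s * \<omega> ^ j"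
    have v: "norm v \<le> r" using s by (simp add: v_def norm_mult norm_power \<omega>_def)
    \<comment> \<open>Hence v^N = s^N for every j, so all summands act on the same vector x - s^N
      T^N x.\<close>
    have "\<omega> ^ (j * N) = 1" using \<omega>N by (simp add: mult.commute[of j] power_mult)
    hence "v ^ N = complex_of_real s ^ N" by (simp add: v_def power_mult_distrib flip: power_mult)
    hence "F v (x - complex_of_real s ^ N *\<^sub>C (T ^^ N) x) = (\<Sum>k<N. v ^ k *\<^sub>C (T ^^ k) x)"
      using left[OF v, of "\<Sum>k<N. v ^ k *\<^sub>C (T ^^ k) x"] by (simp only: clinear_telescope)
    thus ?thesis by (simp add: v_def power_mult_distrib flip: power_mult)
  qed
  hence "(\<Sum>j<N. F (complex_of_real s * \<omega> ^ j) (x - complex_of_real s ^ N *\<^sub>C (T ^^ N) x))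
      = (\<Sum>j<N. \<Sum>k<N. (complex_of_real s ^ k * \<omega> ^ (j * k)) *\<^sub>C (T ^^ k) x)"
    by simp
  also have "\<dots> = (\<Sum>k<N. (complex_of_real s ^ k * (\<Sum>j<N. \<omega> ^ (j * k))) *\<^sub>C (T ^^ k) x)"
    by (subst sum.swap) (simp add: cvec.scale_sum_left sum_distrib_left)
  \<comment> \<open>The root sums vanish for 0 < k < N and equal N at k = 0.\<close>
  also have "\<dots> = (\<Sum>k<N. if k = 0 then of_nat N *\<^sub>C x else 0)"
    using sum_roots_unity_power[of _ N] by (intro sum.cong) (auto simp: \<omega>_def)
  also have "\<dots> = of_nat N *\<^sub>C x" using N by simp
  finally show ?thesis using N by (simp add: resolvent_mean_def \<omega>_def scaleC_scaleC scaleC_one)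
qed

text \<open>Corresponding sample points differ by |s - t| in modulus, so the resolvent identity
  bounds each summand. Averaging keeps the bound, which makes the Lipschitz constant independent of
  N.\<close>

lemma resolvent_mean_diff_le:
  assumes M: "M > 0" "\<And>w x. norm w \<le> r \<Longrightarrow> g (F w x) \<le> M * g x"
    and N: "N > 0" and s: "0 \<le> s" "s \<le> r" "0 \<le> t" "t \<le> r"
  shows "g (resolvent_mean N s x - resolvent_mean N t x) \<le> \<bar>s - t\<bar> * (M * \<tau> * M) * g x"
proof -
  have "g (F (complex_of_real s * cis (2 * pi / N) ^ j) x - F (complex_of_real t * cis (2 * pi / N) ^ j) x)
      \<le> \<bar>s - t\<bar> * (M * \<tau> * M) * g x" for j
  proof -
    define v w where vw: "v = complex_of_real s * cis (2 * pi / N) ^ j"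
      "w = complex_of_real t * cis (2 * pi / N) ^ j"
    have norms: "norm v \<le> r" "norm w \<le> r" using s by (simp_all add: vw norm_mult norm_power)
    have "norm (v - w) = \<bar>s - t\<bar>"
      by (simp add: vw norm_mult norm_power flip: left_diff_distrib of_real_diff)
    hence "g (F v x - F w x) = \<bar>s - t\<bar> * g (F v (T (F w x)))"
      unfolding resolvent_identity[OF norms] seminorm_scale[OF g] by simp
    also have "\<dots> \<le> \<bar>s - t\<bar> * (M * (\<tau> * (M * g x)))"
      using M(1) \<tau>(1)
      by (intro mult_left_mono order_trans[OF M(2)[OF norms(1)]] order_trans[OF \<tau>(2)] M(2) norms) auto
    finally show ?thesis by (simp add: vw mult.assoc)
  qed
  hence "g (\<Sum>j<N. F (complex_of_real s * cis (2 * pi / N) ^ j) x - F (complex_of_real t * cis (2 * pi / N) ^ j) x)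
      \<le> (\<Sum>j<N. \<bar>s - t\<bar> * (M * \<tau> * M) * g x)"
    by (intro order_trans[OF seminorm_sum[OF g]] sum_mono)
  moreover have "resolvent_mean N s x - resolvent_mean N t x = (1 / of_nat N) *\<^sub>C
      (\<Sum>j<N. F (complex_of_real s * cis (2 * pi / N) ^ j) x - F (complex_of_real t * cis (2 * pi / N) ^ j) x)"
    by (simp only: resolvent_mean_def sum_subtractf cvec.scale_right_diff_distrib)
  ultimately show ?thesis using N by (simp add: seminorm_scale[OF g] norm_divide field_simps)
qed

lemma resolvent_mean_le:
  assumes M: "\<And>w x. norm w \<le> r \<Longrightarrow> g (F w x) \<le> M * g x"
    and N: "N > 0" and s: "0 \<le> s" "s \<le> r"
  shows "g (resolvent_mean N s x) \<le> M * g x"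
proof -
  have "g (\<Sum>j<N. F (complex_of_real s * cis (2 * pi / N) ^ j) x) \<le> (\<Sum>j<N. M * g x)"
    using s by (intro order_trans[OF seminorm_sum[OF g]] sum_mono M) (simp add: norm_mult norm_power)
  thus ?thesis using N by (simp add: resolvent_mean_def seminorm_scale[OF g] norm_divide field_simps)
qed

lemma clinear_resolvent_mean:
  assumes "0 \<le> s" "s \<le> r"
  shows "resolvent_mean N s (x - y) = resolvent_mean N s x - resolvent_mean N s y"
proof -
  have "norm (complex_of_real s * cis (2 * pi / N) ^ j) \<le> r" for j
    using assms by (simp add: norm_mult norm_power)
  thus ?thesis
    by (simp add: resolvent_mean_def clinear_diff[OF linF] sum_subtractf cvec.scale_right_diff_distrib)
qed

text \<open>If \<open>s\<^sup>n T\<^sup>n\<close> decays, then the means at \<open>s\<close> approach the identity. The means are Lipschitz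
  uniformly in \<open>n\<close>, so at a nearby \<open>t\<close> they stay within distance \<open>1 / 2\<close> of the identity, which
  bounds \<open>t\<^sup>n T\<^sup>n\<close>.\<close>

lemma powers_decay_step:
  assumes M: "M > 0" "\<And>w x. norm w \<le> r \<Longrightarrow> g (F w x) \<le> M * g x"
    and s: "0 \<le> s" "s \<le> r" "powers_decay g T s"
    and t: "0 \<le> t" "t \<le> r" "\<bar>t - s\<bar> * (M * \<tau> * M) \<le> 1 / 4"
    and u: "0 \<le> u" "u < t"
  shows "powers_decay g T u"
  unfolding powers_decay_def
proof (intro allI impI)
  fix \<epsilon> :: real assume \<epsilon>: "\<epsilon> > 0"
  \<comment> \<open>The means have bound M, so this accuracy yields distance 1 / 4 from the identity
    at s. The move from s to t costs another 1 / 4.\<close>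
  have "1 / (4 * M) > 0" using M(1) by simp
  then obtain n0 where n0: "\<And>n x. n \<ge> n0 \<Longrightarrow> s ^ n * g ((T ^^ n) x) \<le> 1 / (4 * M) * g x"
    using s(3) unfolding powers_decay_def by blast
  have bound: "t ^ n * g ((T ^^ n) x) \<le> g x" if n: "n \<ge> max 1 n0" for n x
  proof -
    have n': "n > 0" "n \<ge> n0" using n by auto
    have near: "g (x - resolvent_mean n t x) \<le> 1 / 2 * g x" for x
    proof -
      have "resolvent_mean n s x - x = resolvent_mean n s (complex_of_real s ^ n *\<^sub>C (T ^^ n) x)"
        using resolvent_mean_left_inverse[OF n'(1) s(1,2), of x] s
        by (simp add: clinear_resolvent_mean algebra_simps)
      hence "g (x - resolvent_mean n s x) \<le> M * g (complex_of_real s ^ n *\<^sub>C (T ^^ n) x)"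
        using resolvent_mean_le[OF M(2) n'(1) s(1,2)] seminorm_minus_commute[OF g] by metis
      also have "\<dots> = M * (s ^ n * g ((T ^^ n) x))"
        using s by (simp add: seminorm_scale[OF g] norm_power)
      also have "\<dots> \<le> M * (1 / (4 * M) * g x)" using M(1) n0[OF n'(2)] by (intro mult_left_mono) auto
      finally have "g (x - resolvent_mean n s x) \<le> 1 / 4 * g x" using M(1) by simp
      moreover have "g (resolvent_mean n s x - resolvent_mean n t x) \<le> \<bar>t - s\<bar> * (M * \<tau> * M) * g x"
        using resolvent_mean_diff_le[OF M n'(1) s(1,2) t(1,2)] by (simp add: abs_minus_commute)
      moreover have "\<bar>t - s\<bar> * (M * \<tau> * M) * g x \<le> 1 / 4 * g x"
        using t(3) by (intro mult_right_mono seminorm_nonneg[OF g])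
      ultimately show ?thesis
        using seminorm_triangle[OF g, of "x - resolvent_mean n s x" "resolvent_mean n s x - resolvent_mean n t x"]
        by simp
    qed
    \<comment> \<open>The mean at t sends x - y back to x, so its error on x - y is -y. This gives g
      y \<le> (g x + g y) / 2, hence g y \<le> g x.\<close>
    define y where "y = complex_of_real t ^ n *\<^sub>C (T ^^ n) x"
    have "g y = g ((x - y) - resolvent_mean n t (x - y))"
      using resolvent_mean_left_inverse[OF n'(1) t(1,2), of x] seminorm_minus[OF g, of y] by (simp add: y_def)
    also have "\<dots> \<le> 1 / 2 * g (x - y)" by (rule near)
    also have "\<dots> \<le> 1 / 2 * (g x + g y)" using seminorm_triangle_diff[OF g] by simp
    finally have "g y \<le> g x" by simp
    thus ?thesis using t by (simp add: y_def seminorm_scale[OF g] norm_power)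
  qed
  \<comment> \<open>At t the powers are only bounded; decay requires the strictly smaller u, through
    the factor (u / t)^n.\<close>
  have "(\<lambda>n. (u / t) ^ n) \<longlonglongrightarrow> 0" using u by (intro LIMSEQ_realpow_zero) auto
  hence "\<forall>\<^sub>F n in sequentially. (u / t) ^ n < \<epsilon>" using \<epsilon> by (rule order_tendstoD)
  then obtain n1 where n1: "\<And>n. n \<ge> n1 \<Longrightarrow> (u / t) ^ n < \<epsilon>" by (auto simp: eventually_sequentially)
  have "u ^ n * g ((T ^^ n) x) \<le> \<epsilon> * g x" if n: "n \<ge> max n1 (max 1 n0)" for n x
  proof -
    have "u ^ n * g ((T ^^ n) x) = (u / t) ^ n * (t ^ n * g ((T ^^ n) x))"
      using u by (simp add: power_divide)
    also have "\<dots> \<le> \<epsilon> * g x"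
      using n n1[of n] bound[of n x] u t \<epsilon> seminorm_nonneg[OF g] by (intro mult_mono) auto
    finally show ?thesis .
  qed
  thus "\<exists>n0. \<forall>n\<ge>n0. \<forall>x. u ^ n * g ((T ^^ n) x) \<le> \<epsilon> * g x" by blast
qed

text \<open>The admissible step length depends only on M and \<tau>, so finitely many steps from 0
  reach any u < r.\<close>

lemma powers_decay_below:
  assumes u: "0 \<le> u" "u < r"
  shows "powers_decay g T u"
proof -
  obtain M where M: "M > 0" "\<And>w x. norm w \<le> r \<Longrightarrow> g (F w x) \<le> M * g x"
    using resolvent_uniformly_bounded by blast
  define d where "d = 1 / (4 * (M * \<tau> * M))"
  have d: "d > 0" "d * (M * \<tau> * M) = 1 / 4" using M(1) \<tau>(1) by (simp_all add: d_def)
  \<comment> \<open>The threshold is n0 = 1, because 0^0 = 1.\<close>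
  have zero: "powers_decay g T 0"
    unfolding powers_decay_def
    using seminorm_nonneg[OF g] by (auto intro!: exI[of _ 1] simp: power_0_left)
  have "powers_decay g T u" if "0 \<le> u" "u < r" "u \<le> real k * (d / 2)" for k u
    using that
  proof (induction k arbitrary: u)
    case 0
    thus ?case using zero by simp
  next
    case (Suc k)
    \<comment> \<open>The induction advances by d / 2 while t may lie d beyond s. This leaves u < t,
      even after t is cut off at r > u.\<close>
    define s where "s = max 0 (u - d / 2)"
    define t where "t = min r (s + d)"
    have "0 \<le> real k * (d / 2)" "u - d / 2 \<le> real k * (d / 2)"
      using d(1) Suc.prems(3) by (simp_all add: algebra_simps)
    hence "s \<le> real k * (d / 2)" by (simp only: s_def max.bounded_iff)
    hence st: "0 \<le> s" "s \<le> u" "s < r" "s \<le> real k * (d / 2)" "u < t" "t \<le> r" "0 \<le> t" "\<bar>t - s\<bar> \<le> d"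
      using Suc.prems d(1) by (auto simp: s_def t_def algebra_simps)
    have "powers_decay g T s" using st by (intro Suc.IH)
    moreover have "\<bar>t - s\<bar> * (M * \<tau> * M) \<le> 1 / 4"
      using mult_right_mono[OF st(8), of "M * \<tau> * M"] M(1) \<tau>(1) d(2) by simp
    ultimately show ?case using st Suc.prems by (intro powers_decay_step[OF M, of s t u]) auto
  qed
  moreover obtain k :: nat where "u / (d / 2) \<le> real k" using real_arch_simple by blast
  ultimately show ?thesis using u d(1) by (simp add: field_simps)
qed

end

text \<open>The substitution w = 1 / z turns the region |z| \<ge> \<mu> into the disc |w| \<le> 1 /
  \<mu>, on which I - w T is invertible. The powers then decay at 1 / \<nu> < 1 / \<mu>.\<close>

lemma r_lb_le_of_resolvent:
  fixes T :: "'a::locally_convex_space \<Rightarrow> 'a"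
  assumes T: "locally_bounded_op T" and \<mu>: "0 < \<mu>" "\<mu> < \<nu>"
    and res: "\<And>z. \<mu> \<le> norm z \<Longrightarrow> z \<notin> spectrum T"
  shows "r_lb T \<le> ennreal \<nu>"
proof -
  obtain g where lin: "clinear T" and g: "continuous_seminorm g" "bounded_by g T"
    using T unfolding locally_bounded_op_iff by blast
  note sg = continuous_seminorm_is_seminorm[OF g(1)]
  obtain \<tau> where \<tau>: "\<tau> > 0" "\<And>x. g (T x) \<le> \<tau> * g x" using g by (metis bounded_byD)
  have "\<exists>R. clinear R \<and> continuous_on UNIV R \<and> (\<forall>x. R (x - w *\<^sub>C T x) = x) \<and> (\<forall>x. R x - w *\<^sub>C T (R x) = x)"
    if w: "norm w \<le> 1 / \<mu>" for w
  \<comment> \<open>The point w = 0 corresponds to z at infinity, where the inverse is the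
    identity.\<close>
  proof (cases "w = 0")
    case True
    thus ?thesis by (intro exI[of _ "\<lambda>x. x"]) (simp add: clinear_iff)
  next
    case False
    hence "\<mu> \<le> norm (inverse w)" using w \<mu>(1) by (simp add: norm_inverse norm_divide field_simps)
    then obtain R where R: "clinear R" "continuous_on UNIV R"
      "\<And>x. R (inverse w *\<^sub>C x - T x) = x" "\<And>x. inverse w *\<^sub>C R x - T (R x) = x"
      using res unfolding spectrum_def resolvent_in_def by blast
    define Q where "Q x = inverse w *\<^sub>C R x" for x
    have "clinear Q"
      using R(1) by (simp add: clinear_iff Q_def scaleC_add_right scaleC_scaleC mult.commute)
    moreover have "continuous_on UNIV Q"
      using continuous_on_compose2[OF continuous_on_scaleC_left R(2)] by (simp add: Q_def[abs_def])
    moreover have "Q (x - w *\<^sub>C T x) = x" for x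
    proof -
      have "inverse w *\<^sub>C (x - w *\<^sub>C T x) = inverse w *\<^sub>C x - T x"
        using False by (simp add: cvec.scale_right_diff_distrib scaleC_scaleC scaleC_one)
      thus ?thesis using R(3)[of x] by (simp add: Q_def flip: clinear_scale[OF R(1)])
    qed
    moreover have "Q x - w *\<^sub>C T (Q x) = x" for x
      using R(4)[of x] False by (simp add: Q_def clinear_scale[OF lin] scaleC_scaleC scaleC_one)
    ultimately show ?thesis by blast
  qed
  then obtain F where F: "\<And>w. norm w \<le> 1 / \<mu> \<Longrightarrow> clinear (F w)"
    "\<And>w. norm w \<le> 1 / \<mu> \<Longrightarrow> continuous_on UNIV (F w)"
    "\<And>w x. norm w \<le> 1 / \<mu> \<Longrightarrow> F w (x - w *\<^sub>C T x) = x"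
    "\<And>w x. norm w \<le> 1 / \<mu> \<Longrightarrow> F w x - w *\<^sub>C T (F w x) = x"
    by metis
  \<comment> \<open>Continuity alone does not bound \<open>F w\<close> by a multiple of
    \<open>g\<close>. In F w = I + w F w T the inner T supplies this bound, since g o F w is a
    continuous seminorm.\<close>
  have bdF: "\<exists>C. \<forall>x. g (F w x) \<le> C * g x" if w: "norm w \<le> 1 / \<mu>" for w
  proof -
    have "continuous_seminorm (\<lambda>x. g (F w x))"
      using g(1) F(1,2)[OF w] by (rule continuous_seminorm_comp)
    with g(2) obtain C where C: "\<And>x. g (F w (T x)) \<le> C * g x" by (rule bounded_byD) blast
    have "g (F w x) \<le> (1 + norm w * C) * g x" for x
    proof -
      have "F w x = x + w *\<^sub>C F w (T x)"
        using F(3)[OF w, of x] by (simp add: clinear_diff[OF F(1)[OF w]] clinear_scale[OF F(1)[OF w]] diff_eq_eq)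
      hence "g (F w x) \<le> g x + norm w * g (F w (T x))"
        using seminorm_triangle[OF sg] by (metis seminorm_scale[OF sg])
      also have "\<dots> \<le> g x + norm w * (C * g x)" by (intro add_left_mono mult_left_mono C) simp
      finally show ?thesis by (simp add: algebra_simps)
    qed
    thus ?thesis by blast
  qed
  have decay: "powers_decay g T (1 / \<nu>)"
    using F(1,3,4) bdF \<mu> by (intro powers_decay_below[OF sg lin \<tau>, of "1 / \<mu>" F]) (simp_all add: field_simps)
  have "uniformly_to_zero_on {x. g x < 1} (\<lambda>n x. (T ^^ n) x /\<^sub>R \<nu> ^ n)"
    unfolding uniformly_to_zero_on_def
  proof safe
    fix V :: "'a set" assume "zero_neighborhood V"
    then obtain q where q: "continuous_seminorm q" "{x. q x < 1} \<subseteq> V"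
      by (rule continuous_seminorm_below_neighborhood)
    note sq = continuous_seminorm_is_seminorm[OF q(1)]
    obtain C where C: "C > 0" "\<And>x. q (T x) \<le> C * g x" using g(2) q(1) by (metis bounded_byD)
    \<comment> \<open>One factor T is spent on passing from \<open>q\<close> to \<open>g\<close> at
      the cost C / \<nu>, which this accuracy cancels.\<close>
    have "\<nu> / C > 0" using \<mu> C(1) by simp
    then obtain n0 where n0: "\<And>n x. n \<ge> n0 \<Longrightarrow> (1 / \<nu>) ^ n * g ((T ^^ n) x) \<le> \<nu> / C * g x"
      using decay unfolding powers_decay_def by blast
    have "(T ^^ n) x /\<^sub>R \<nu> ^ n \<in> V" if n: "n \<ge> Suc n0" and x: "g x < 1" for n x
    proof -
      obtain m where m: "n = Suc m" "m \<ge> n0" using n by (cases n) auto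
      have "q ((T ^^ n) x /\<^sub>R \<nu> ^ n) = (1 / \<nu>) ^ n * q (T ((T ^^ m) x))"
        using \<mu> by (simp add: m scaleR_scaleC seminorm_scale[OF sq] norm_mult norm_inverse norm_divide
            norm_power power_divide field_simps)
      also have "\<dots> \<le> (1 / \<nu>) ^ n * (C * g ((T ^^ m) x))"
        using \<mu> by (intro mult_left_mono C(2)) auto
      also have "\<dots> = C / \<nu> * ((1 / \<nu>) ^ m * g ((T ^^ m) x))" by (simp add: m)
      also have "\<dots> \<le> C / \<nu> * (\<nu> / C * g x)"
        using C(1) \<mu> n0[OF m(2)] by (intro mult_left_mono) auto
      also have "\<dots> < 1" using C(1) \<mu> x by simp
      finally show ?thesis using q(2) by blast
    qed
    thus "\<exists>n0. \<forall>n\<ge>n0. (\<lambda>x. (T ^^ n) x /\<^sub>R \<nu> ^ n) ` {x. g x < 1} \<subseteq> V" by blast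
  qed
  moreover have "zero_neighborhood {x. g x < 1}" using g(1) by (simp add: continuous_seminorm_def)
  ultimately show ?thesis
    unfolding r_lb_def using \<mu> by (intro Inf_lower) auto
qed

theorem proposition3p14:
  fixes T :: "'a::locally_convex_space \<Rightarrow> 'a"
  assumes "seq_complete (UNIV :: 'a set)"
    and "locally_bounded_op T"
  shows "r_lb T = set_radius (spectrum T) \<and>
    set_radius (spectrum T) = set_radius (spectrum_lb T) \<and>
    set_radius (spectrum_lb T) = set_radius (spectrum_Q T)"
proof -
  have "set_radius (spectrum_lb T) \<le> r_lb T" "set_radius (spectrum_Q T) \<le> r_lb T"
    unfolding set_radius_def using resolvent_outside_r_lb[OF assms] by (meson SUP_least not_le)+
  moreover have "set_radius (spectrum T) \<le> set_radius (spectrum_lb T)"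
    "set_radius (spectrum T) \<le> set_radius (spectrum_Q T)"
    unfolding set_radius_def by (intro SUP_subset_mono spectrum_subset_lb spectrum_subset_Q order_refl)+
  moreover have "r_lb T \<le> set_radius (spectrum T)"
  proof (rule dense_ge)
    fix c assume c: "set_radius (spectrum T) < c"
    show "r_lb T \<le> c"
    proof (cases c)
      case (real \<nu>)
      \<comment> \<open>Strictness matters: since the radius is below \<open>b\<close>, no spectral
        point has modulus \<mu> or more, and \<mu> > 0.\<close>
      then obtain b where b: "set_radius (spectrum T) < b" "b < ennreal \<nu>" using c dense by blast
      then obtain \<mu> where \<mu>: "b = ennreal \<mu>" "0 \<le> \<mu>" by (cases b) auto
      have "0 < \<mu>" using b \<mu> by (metis ennreal_0 not_less_zero order_le_less)
      moreover have "\<mu> < \<nu>" using b \<mu> by (simp add: ennreal_less_iff)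
      moreover have "z \<notin> spectrum T" if "\<mu> \<le> norm z" for z
      proof
        assume "z \<in> spectrum T"
        hence "ennreal (norm z) \<le> set_radius (spectrum T)"
          unfolding set_radius_def by (rule SUP_upper)
        hence "ennreal (norm z) < ennreal \<mu>" using b \<mu> by simp
        thus False using that by (simp add: ennreal_less_iff)
      qed
      ultimately show ?thesis using r_lb_le_of_resolvent[OF assms(2)] real by blast
    qed simp
  qed
  ultimately show ?thesis by (meson order.antisym order_trans)
qed

end
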